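(* Let $a:V\times V\to\mathbb C$ be a bounded, coercive and symmetric form with associated operator $A$ in $H$, and let $(A_m)_{m\in\mathbb N}$ be the (Galerkin) space discretization of $A$ given by an approximating sequence $(V_m)_{m\in\mathbb N}$ of $V$. Let $s>0$ and $p_1,p_2\ge0$ be such that $(\gamma_m(\operatorname{dom}(A^s)))_{m\in\mathbb N}$ decays with rate $p_1=p_1(s)$ and $(\gamma_m^*(H))_{m\in\mathbb N}$ decays with rate $p_2$. Then for all $\bar T\ge0$ there exists $C_{\mathrm x}=C_{\mathrm x}(\bar T,s)$ such that $$\|J_mT_m(t)P_mu_0-T(t)u_0\|_H\le C_{\mathrm x}\frac{\|u_0\|_{A^{s+1}}}{m^{p_1+p_2}}$$ for all $t\in[0,\bar T]$, $u_0\in\operatorname{dom}(A^{s+1})$ and $m\in\mathbb N$. Moreover, if $p_1+p_2>0$, the space discretization $(A_m)_{m\in\mathbb N}$ converges of order $p_1+p_2$ on $\operatorname{dom}(A^{s+1})$ for the evolution problem.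
   Context: $V,H$ are separable Hilbert spaces, $V\hookrightarrow H$ with $V$ dense in $H$, so $V\hookrightarrow H\hookrightarrow V^*$ with $V^*$ the antidual of $V$. A form $a$ on $V$ is a sesquilinear map; it is bounded if $|a(u,v)|\le K\|u\|_V\|v\|_V$, coercive if $\operatorname{Re}a(u,u)\ge\kappa\|u\|_V^2$ for some $\kappa>0$, symmetric if $a(u,v)=\overline{a(v,u)}$. Put $\mathcal A:V\to V^*$, $\mathcal Au=a(u,\cdot)$, and let $\mathcal A^*$ be the analogous operator for the adjoint form $a^*(u,v)=\overline{a(v,u)}$. The operator $A$ in $H$ associated with $a$ is the restriction of $\mathcal A$ to $\operatorname{dom}(A)=\mathcal A^{-1}(H)$, i.e. $a(u,v)=(Au|v)_H$ for $u\in\operatorname{dom}(A)$, $v\in V$. $-A$ generates a contractive $C_0$-semigroup $(T(t))_{t\ge0}$ on $H$. The graph norm is $\|u\|_{A^s}=(\|A^su\|_H^2+\|u\|_H^2)^{1/2}$, with which $\operatorname{dom}(A^s)$ is equipped. An approximating sequence of $V$ is a sequence $(V_m)$ of closed subspaces of $V$ with $\operatorname{dist}_V(v,V_m)\to0$ for all $v\in V$. $H_m$ is the closure of $V_m$ in $H$, $P_m:H\to H_m$ the $H$-orthogonal projection, $J_m:H_m\to H$ the canonical embedding, $A_m$ the operator in $H_m$ associated with $a|_{V_m\times V_m}$, and $(T_m(t))_{t\ge0}$ the $C_0$-semigroup on $H_m$ generated by $-A_m$. For a Banach space $\mathcal X\hookrightarrow V^*$: $\gamma_m(\mathcal X)=\sup_{f\in\mathcal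 X,\|f\|_{\mathcal X}=1}\operatorname{dist}_V(\mathcal A^{-1}f,V_m)$, and $\gamma_m^*(\mathcal X)$ is defined analogously with $\mathcal A^*$ in place of $\mathcal A$. Such a sequence decays with rate $p\ge0$ if it is bounded by $C m^{-p}$ for all $m\in\mathbb N$ with some constant $C\ge0$. For $Y\hookrightarrow H$ and $p>0$, $(A_m)$ converges of order $p$ on $Y$ for the evolution problem if for all $\bar T\ge0$ there is $C\ge0$ with $\|J_mT_m(t)P_mu_0-T(t)u_0\|_H\le Cm^{-p}\|u_0\|_Y$ for all $t\in[0,\bar T]$, $u_0\in Y$, $m\in\mathbb N$. *)

theory Defs
  imports "HOL-Analysis.Analysis"
begin

text \<open>
  Complex Hilbert spaces are types; separability is expressed by the additional sort
  \<open>second_countable_topology\<close>. Inner products, sesquilinear forms and the duality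
  between a space and its antidual are linear in the first and antilinear in the second argument.
  Norm and topology are those of the underlying real inner product, which is the real part of
  the complex one, so positive definiteness is inherited from \<open>real_inner\<close>.
\<close>

class complex_inner = real_inner +
  fixes scaleC :: "complex \<Rightarrow> 'a \<Rightarrow> 'a"  (infixr "*\<^sub>C" 75)
    and cinner :: "'a \<Rightarrow> 'a \<Rightarrow> complex"
  assumes scaleC_add_right: "c *\<^sub>C (x + y) = c *\<^sub>C x + c *\<^sub>C y"
    and scaleC_add_left: "(c + d) *\<^sub>C x = c *\<^sub>C x + d *\<^sub>C x"
    and scaleC_scaleC: "c *\<^sub>C d *\<^sub>C x = (c * d) *\<^sub>C x"
    and scaleR_scaleC: "r *\<^sub>R x = complex_of_real r *\<^sub>C x"
    and cinner_add_left: "cinner (x + y) z = cinner x z + cinner y z"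
    and cinner_scaleC_left: "cinner (c *\<^sub>C x) y = c * cinner x y"
    and cinner_commute: "cinner x y = cnj (cinner y x)"
    and inner_eq_Re_cinner: "x \<bullet> y = Re (cinner x y)"

class complex_hilbert = complex_inner + banach

instantiation complex :: complex_hilbert
begin

definition scaleC_complex :: "complex \<Rightarrow> complex \<Rightarrow> complex"
  where "scaleC_complex c x = c * x"

definition cinner_complex :: "complex \<Rightarrow> complex \<Rightarrow> complex"
  where "cinner_complex x y = x * cnj y"

instance
  by standard
    (simp_all add: scaleC_complex_def cinner_complex_def algebra_simps
      scaleR_conv_of_real inner_complex_def)

end

definition csubspace :: "'a::complex_inner set \<Rightarrow> bool"
  where "csubspace S \<longleftrightarrow>
    0 \<in> S \<and> (\<forall>x\<in>S. \<forall>y\<in>S. x + y \<in> S) \<and> (\<forall>c. \<forall>x\<in>S. c *\<^sub>C x \<in> S)"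

definition bounded_clinear_on ::
    "'a::complex_inner set \<Rightarrow> ('a \<Rightarrow> 'b::complex_inner) \<Rightarrow> bool"
  where "bounded_clinear_on S f \<longleftrightarrow>
    (\<forall>x\<in>S. \<forall>y\<in>S. f (x + y) = f x + f y) \<and>
    (\<forall>c. \<forall>x\<in>S. f (c *\<^sub>C x) = c *\<^sub>C f x) \<and>
    (\<exists>K. \<forall>x\<in>S. norm (f x) \<le> K * norm x)"

definition dense_embedding :: "('v::complex_inner \<Rightarrow> 'h::complex_inner) \<Rightarrow> bool"
  where "dense_embedding j \<longleftrightarrow>
    bounded_clinear_on UNIV j \<and> inj j \<and> closure (range j) = UNIV"

definition orth_proj :: "'h::complex_inner set \<Rightarrow> 'h \<Rightarrow> 'h"
  where "orth_proj S x = (THE y. y \<in> S \<and> (\<forall>z\<in>S. cinner (x - y) z = 0))"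


section \<open>Forms\<close>

definition sesquilinear :: "('v::complex_inner \<Rightarrow> 'v \<Rightarrow> complex) \<Rightarrow> bool"
  where "sesquilinear a \<longleftrightarrow>
    (\<forall>u u' v. a (u + u') v = a u v + a u' v) \<and>
    (\<forall>c u v. a (c *\<^sub>C u) v = c * a u v) \<and>
    (\<forall>u v v'. a u (v + v') = a u v + a u v') \<and>
    (\<forall>c u v. a u (c *\<^sub>C v) = cnj c * a u v)"

definition bounded_form :: "('v::complex_inner \<Rightarrow> 'v \<Rightarrow> complex) \<Rightarrow> bool"
  where "bounded_form a \<longleftrightarrow> (\<exists>K. \<forall>u v. cmod (a u v) \<le> K * norm u * norm v)"

definition coercive_form :: "('v::complex_inner \<Rightarrow> 'v \<Rightarrow> complex) \<Rightarrow> bool"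
  where "coercive_form a \<longleftrightarrow> (\<exists>\<kappa>>0. \<forall>u. Re (a u u) \<ge> \<kappa> * (norm u)\<^sup>2)"

definition symmetric_form :: "('v \<Rightarrow> 'v \<Rightarrow> complex) \<Rightarrow> bool"
  where "symmetric_form a \<longleftrightarrow> (\<forall>u v. a u v = cnj (a v u))"

definition adjoint_form :: "('v \<Rightarrow> 'v \<Rightarrow> complex) \<Rightarrow> 'v \<Rightarrow> 'v \<Rightarrow> complex"
  where "adjoint_form a u v = cnj (a v u)"

text \<open>
  Elements of the antidual of \<open>'v\<close> are functions \<open>'v \<Rightarrow> complex\<close>, so that the operator
  from \<open>'v\<close> to its antidual induced by the form \<open>a\<close>, sending \<open>u\<close> to \<open>a(u, \<cdot>)\<close>, is the curried
  function \<open>a\<close> itself. By Lax-Milgram the description below is proper for every functional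
  in the antidual if \<open>a\<close> is bounded and coercive.
\<close>

definition form_inverse :: "('v \<Rightarrow> 'v \<Rightarrow> complex) \<Rightarrow> ('v \<Rightarrow> complex) \<Rightarrow> 'v"
  where "form_inverse a \<phi> = (THE u. a u = \<phi>)"

definition to_antidual :: "('v \<Rightarrow> 'h::complex_inner) \<Rightarrow> 'h \<Rightarrow> 'v \<Rightarrow> complex"
  where "to_antidual j f = (\<lambda>v. cinner f (j v))"


section \<open>Unbounded operators, given by their graphs\<close>

text \<open>
  The operator associated with the restriction of \<open>a\<close> to \<open>W \<times> W\<close> in the Hilbert space
  obtained as the closure of \<open>W\<close> in \<open>'h\<close>. For \<open>W = UNIV\<close> and \<open>j\<close> of dense range this is an
  operator in \<open>'h\<close>.
\<close>

definition form_operator ::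
    "('v \<Rightarrow> 'h::complex_inner) \<Rightarrow> ('v \<Rightarrow> 'v \<Rightarrow> complex) \<Rightarrow> 'v set \<Rightarrow> ('h \<times> 'h) set"
  where "form_operator j a W =
    {(j u, f) | u f. u \<in> W \<and> f \<in> closure (j ` W) \<and> (\<forall>v\<in>W. a u v = cinner f (j v))}"

definition op_apply :: "('h \<times> 'h) set \<Rightarrow> 'h \<Rightarrow> 'h"
  where "op_apply B x = (THE y. (x, y) \<in> B)"

definition graph_norm :: "('h::real_normed_vector \<times> 'h) set \<Rightarrow> 'h \<Rightarrow> real"
  where "graph_norm B x = sqrt ((norm (op_apply B x))\<^sup>2 + (norm x)\<^sup>2)"

text \<open>
  Semigroups live on a closed subspace \<open>X\<close> of the ambient type; \<open>T t\<close> is unconstrained outside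
  \<open>X\<close> and for \<open>t < 0\<close>.
\<close>

definition C0_semigroup :: "'h::complex_inner set \<Rightarrow> (real \<Rightarrow> 'h \<Rightarrow> 'h) \<Rightarrow> bool"
  where "C0_semigroup X T \<longleftrightarrow>
    (\<forall>t\<ge>0. T t ` X \<subseteq> X \<and> bounded_clinear_on X (T t)) \<and>
    (\<forall>x\<in>X. T 0 x = x) \<and>
    (\<forall>r\<ge>0. \<forall>t\<ge>0. \<forall>x\<in>X. T (r + t) x = T r (T t x)) \<and>
    (\<forall>x\<in>X. ((\<lambda>t. T t x) \<longlongrightarrow> x) (at_right 0))"

definition generator :: "'h::complex_inner set \<Rightarrow> (real \<Rightarrow> 'h \<Rightarrow> 'h) \<Rightarrow> ('h \<times> 'h) set"
  where "generator X T =
    {(x, y). x \<in> X \<and> y \<in> X \<and> ((\<lambda>t. (1 / t) *\<^sub>R (T t x - x)) \<longlongrightarrow> y) (at_right 0)}"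

text \<open>\<open>T\<close> is the \<open>C\<^sub>0\<close>-semigroup on \<open>X\<close> generated by \<open>-B\<close>.\<close>

definition generated_by_neg ::
    "'h::complex_inner set \<Rightarrow> (real \<Rightarrow> 'h \<Rightarrow> 'h) \<Rightarrow> ('h \<times> 'h) set \<Rightarrow> bool"
  where "generated_by_neg X T B \<longleftrightarrow>
    C0_semigroup X T \<and> generator X T = {(x, - y) | x y. (x, y) \<in> B}"

text \<open>
  Fractional powers of exponent \<open>s > 0\<close> of an operator \<open>B\<close> for which \<open>-B\<close> generates an
  exponentially stable \<open>C\<^sub>0\<close>-semigroup \<open>T\<close>: the negative power is the Bochner integral
    \<open>B\<^sup>-\<^sup>s y = 1 / \<Gamma>(s) \<integral>\<^sub>0\<^sup>\<infinity> t\<^sup>s\<^sup>-\<^sup>1 T(t) y dt\<close>,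
  and \<open>B\<^sup>s\<close> is its inverse, with domain the range of \<open>B\<^sup>-\<^sup>s\<close> (Pazy, Semigroups of Linear
  Operators, Section 2.6). For positive self-adjoint \<open>B\<close> bounded away from 0 this is the
  power given by the spectral functional calculus. The semigroup is determined by \<open>B\<close>.
\<close>

definition frac_power ::
    "('h::{complex_hilbert, second_countable_topology} \<times> 'h) set \<Rightarrow> real \<Rightarrow> ('h \<times> 'h) set"
  where "frac_power B s =
    {(x, y). \<exists>T. generated_by_neg UNIV T B \<and>
      has_bochner_integral lborel
        (\<lambda>t. indicator {0<..} t *\<^sub>R (t powr (s - 1) / Gamma s) *\<^sub>R T t y) x}"


section \<open>Galerkin approximation\<close>

text \<open>
  Sequences are indexed by the positive integers, since \<open>m\<^sup>-\<^sup>p\<close> occurs throughout; entries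
  with index 0 are ignored.
\<close>

definition approximating_sequence :: "(nat \<Rightarrow> 'v::complex_inner set) \<Rightarrow> bool"
  where "approximating_sequence V \<longleftrightarrow>
    (\<forall>m\<ge>1. csubspace (V m) \<and> closed (V m)) \<and>
    (\<forall>v. (\<lambda>m. infdist v (V m)) \<longlonglongrightarrow> 0)"

text \<open>
  \<open>X\<close> with norm \<open>nrm\<close> is a normed space, embedded into the antidual by \<open>\<iota>\<close>. The supremum is
  taken in \<open>[0, \<infinity>]\<close>, so that it is 0 if \<open>X\<close> is the zero space.
\<close>

definition galerkin_gamma ::
    "('v::metric_space \<Rightarrow> 'v \<Rightarrow> complex) \<Rightarrow> 'v set \<Rightarrow>
      ('x \<Rightarrow> 'v \<Rightarrow> complex) \<Rightarrow> 'x set \<Rightarrow> ('x \<Rightarrow> real) \<Rightarrow> ennreal"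
  where "galerkin_gamma a W \<iota> X nrm =
    (SUP f\<in>{f \<in> X. nrm f = 1}. ennreal (infdist (form_inverse a (\<iota> f)) W))"

definition decays_with_rate :: "(nat \<Rightarrow> ennreal) \<Rightarrow> real \<Rightarrow> bool"
  where "decays_with_rate g p \<longleftrightarrow>
    (\<exists>C\<ge>0. \<forall>m\<ge>1. g m \<le> ennreal (C * real m powr (- p)))"

text \<open>
  \<open>Hm m\<close> is a closed subspace of \<open>'h\<close> carrying the semigroup \<open>Tm m\<close>; its canonical embedding
  into \<open>'h\<close> is the identity and therefore not written.
\<close>

definition evolution_convergence_of_order ::
    "(real \<Rightarrow> 'h::complex_inner \<Rightarrow> 'h) \<Rightarrow> (nat \<Rightarrow> 'h set) \<Rightarrow> (nat \<Rightarrow> real \<Rightarrow> 'h \<Rightarrow> 'h) \<Rightarrow>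
      'h set \<Rightarrow> ('h \<Rightarrow> real) \<Rightarrow> real \<Rightarrow> bool"
  where "evolution_convergence_of_order T Hm Tm Y nrm p \<longleftrightarrow>
    p > 0 \<and>
    (\<forall>Tbar\<ge>0. \<exists>C\<ge>0. \<forall>t\<in>{0..Tbar}. \<forall>u0\<in>Y. \<forall>m\<ge>1.
      norm (Tm m t (orth_proj (Hm m) u0) - T t u0) \<le> C * real m powr (- p) * nrm u0)"

end

theory Submission
  imports Defs
begin

text \<open>
  Why the theorem is true. Write \<open>G = A\<^sup>-\<^sup>1\<close> and \<open>G\<^sub>m = A\<^sub>m\<^sup>-\<^sup>1 P\<^sub>m\<close>; both are bounded, symmetric and
  nonnegative on \<open>H\<close>, and \<open>G f - G\<^sub>m f\<close> is the error of the Galerkin method for the stationary problem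
  \<open>A u = f\<close>. Cea's lemma and the Aubin-Nitsche duality argument bound it by a constant times
  \<open>\<gamma>\<^sub>m(dom(A\<^sup>s)) \<gamma>\<^sub>m\<^sup>*(H)\<close> times the graph norm of \<open>f\<close>, that is, with rate \<open>p1 + p2\<close> (lemmas \<open>cea\<close> and
  \<open>aubin_nitsche\<close>).

  The evolution error \<open>e(t) = T\<^sub>m(t) P\<^sub>m u\<^sub>0 - T(t) u\<^sub>0\<close> satisfies \<open>G\<^sub>m e' + e = \<rho>\<close>, where
  \<open>\<rho>(t) = (G\<^sub>m - G) A T(t) u\<^sub>0\<close> is the stationary error along the exact orbit. An energy estimate with weight \<open>t\<close>
  bounds \<open>|e(t)|\<close> by four times the supremum of \<open>|\<rho>(r)|\<close> and \<open>r |\<rho>'(r)|\<close> for \<open>r \<ge> 0\<close> (lemma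
  \<open>error_energy_estimate\<close>). For \<open>u\<^sub>0 = A\<^bsup>-(s+1)\<^esup> y\<close>, the orbit \<open>A T(r) u\<^sub>0 = A\<^sup>-\<^sup>s T(r) y\<close>
  stays bounded in \<open>dom(A\<^sup>s)\<close>, and by analyticity of the semigroup so does \<open>r\<close> times its derivative (lemma
  \<open>analyticity_bound\<close>). Hence both quantities inherit the rate \<open>p1 + p2\<close>.

  No spectral theorem enters. Self-adjointness is used through symmetry of \<open>G\<close>, \<open>G\<^sub>m\<close> and \<open>T(t)\<close>,
  the fractional powers are treated as the Bochner integrals by which they are defined, and the regularity
  needed for differentiating is removed by density at the end. All estimates concern norms,
  so they are carried out with the real inner product; the complex structure only enters in identifying
  the real solution operators with the given complex operators.
\<close>

section \<open>Minimization of quadratic energies\<close>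

text \<open>
  The first-variation argument: a parabola through the origin that stays nonnegative has a
  horizontal tangent there.
\<close>

lemma quadratic_nonneg_imp_linear_zero:
  fixes p q :: real
  assumes "\<And>t. 2 * t * p + t\<^sup>2 * q \<ge> 0"
  shows "p = 0"
proof -
  have q: "q \<ge> 0" using assms[of 1] assms[of "-1"] by simp
  \<comment> \<open>at \<open>- p r\<close> the parabola has the value \<open>r p\<^sup>2 (r q - 2) \<le> - r p\<^sup>2\<close>\<close>
  define r where "r = 1 / (q + 1)"
  have r: "r > 0" "r * q \<le> 1" using q by (simp_all add: r_def)
  have "0 \<le> 2 * (- p * r) * p + (- p * r)\<^sup>2 * q" by (rule assms)
  also have "\<dots> = r * p\<^sup>2 * (r * q - 2)" by (simp add: power2_eq_square algebra_simps)
  finally have "0 \<le> r * p\<^sup>2 * (r * q - 2)" .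
  moreover have "r * p\<^sup>2 * (r * q - 2) \<le> - (r * p\<^sup>2)"
    using mult_left_mono[of "r * q - 2" "- 1" "r * p\<^sup>2"] r by simp
  ultimately have "r * p\<^sup>2 \<le> 0" by linarith
  then show ?thesis using r by (simp add: mult_le_0_iff)
qed

text \<open>
  The direct method of the calculus of variations: \<open>u\<close> minimizes the energy
  \<open>b(u,u) - 2 \<phi>(u)\<close> over \<open>W\<close>. The energy is bounded below by coercivity, minimizing
  sequences are Cauchy by the parallelogram law for \<open>b\<close>, and vanishing of the first variation
  at the minimum is the asserted equation. With \<open>b\<close> the form this is Lax-Milgram for symmetric forms
  (for \<open>W\<close> the whole space) and the solvability of the Galerkin equations (for \<open>W\<close> a Galerkin
  space); with \<open>b\<close> the inner product it is the orthogonal projection onto \<open>W\<close>.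
\<close>

lemma coercive_form_represents_functional:
  fixes b :: "'v::{real_inner,banach} \<Rightarrow> 'v \<Rightarrow> real"
  assumes b: "bounded_bilinear b" and sym: "\<And>u v. b u v = b v u"
    and k: "k > 0" and coercive: "\<And>u. k * (norm u)\<^sup>2 \<le> b u u"
    and W: "subspace W" "closed W" and \<phi>: "bounded_linear \<phi>"
  shows "\<exists>u\<in>W. \<forall>v\<in>W. b u v = \<phi> v"
proof -
  interpret b: bounded_bilinear b by (rule b)
  interpret \<phi>: bounded_linear \<phi> by (rule \<phi>)
  define J where "J u = b u u - 2 * \<phi> u" for u
  obtain L where L: "\<And>u. \<bar>\<phi> u\<bar> \<le> norm u * L"
    using \<phi>.bounded by (auto simp: real_norm_def)
  \<comment> \<open>complete the square in the lower bound \<open>k |u|\<^sup>2 - 2 L |u|\<close> of the energy\<close>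
  have J_lower: "J u \<ge> - (L\<^sup>2 / k)" for u
  proof -
    have "0 \<le> (k * norm u - L)\<^sup>2" by simp
    then have "0 \<le> k * (k * (norm u)\<^sup>2 - 2 * (norm u * L) + L\<^sup>2 / k)"
      using k by (simp add: power2_eq_square algebra_simps)
    then have "0 \<le> k * (norm u)\<^sup>2 - 2 * (norm u * L) + L\<^sup>2 / k"
      using k by (simp add: zero_le_mult_iff)
    moreover have "\<phi> u \<le> norm u * L" using L[of u] by linarith
    ultimately show ?thesis using coercive[of u] by (simp add: J_def)
  qed
  define d where "d = Inf (J ` W)"
  have "0 \<in> W" using W(1) by (simp add: subspace_0)
  have bdd: "bdd_below (J ` W)" using J_lower by (auto simp: bdd_below_def)
  have d_le: "d \<le> J u" if "u \<in> W" for u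
    unfolding d_def using that by (intro cInf_lower bdd) auto
  have "\<exists>u\<in>W. J u < d + inverse (real (Suc n))" for n
  proof -
    have "Inf (J ` W) < d + inverse (real (Suc n))" by (simp add: d_def)
    then show ?thesis using cInf_lessD[of "J ` W"] \<open>0 \<in> W\<close> by auto
  qed
  then obtain x where xW: "\<And>n. x n \<in> W" and xJ: "\<And>n. J (x n) < d + inverse (real (Suc n))"
    by metis
  \<comment> \<open>the parallelogram law for \<open>b\<close>: midpoints stay in \<open>W\<close>, so their value is at least \<open>d\<close>\<close>
  have dist_bound: "k * (norm (u - v))\<^sup>2 \<le> 2 * (J u - d) + 2 * (J v - d)"
    if "u \<in> W" "v \<in> W" for u v
  proof -
    have "(1/2) *\<^sub>R (u + v) \<in> W" using that W(1) by (simp add: subspace_add subspace_scale)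
    then have "d \<le> J ((1/2) *\<^sub>R (u + v))" by (rule d_le)
    moreover have "4 * J ((1/2) *\<^sub>R w) = b w w - 4 * \<phi> w" for w
      by (simp add: J_def b.scaleR_left b.scaleR_right \<phi>.scaleR)
    moreover have "b (u + v) (u + v) = b u u + 2 * b u v + b v v"
      by (simp add: b.add_left b.add_right sym[of v u])
    moreover have "b (u - v) (u - v) = b u u - 2 * b u v + b v v"
      by (simp add: b.diff_left b.diff_right sym[of v u])
    moreover have "\<phi> (u + v) = \<phi> u + \<phi> v" by (rule \<phi>.add)
    moreover have "J u = b u u - 2 * \<phi> u" "J v = b v v - 2 * \<phi> v" by (simp_all add: J_def)
    ultimately show ?thesis using coercive[of "u - v"] by smt
  qed
  have "Cauchy x"
  proof (rule metric_CauchyI)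
    fix e :: real assume "e > 0"
    then have "4 / (k * e\<^sup>2) > 0" using k by simp
    obtain M where M: "real M > 4 / (k * e\<^sup>2)" using reals_Archimedean2 by blast
    show "\<exists>M. \<forall>m\<ge>M. \<forall>n\<ge>M. dist (x m) (x n) < e"
    proof (intro exI allI impI)
      fix m n assume mn: "m \<ge> M" "n \<ge> M"
      have inv: "J (x i) - d < k * e\<^sup>2 / 4" if "i \<ge> M" for i
      proof -
        have "4 / (k * e\<^sup>2) < real (Suc i)" using that M by simp
        then have "inverse (real (Suc i)) < inverse (4 / (k * e\<^sup>2))"
          by (rule less_imp_inverse_less) (use \<open>4 / (k * e\<^sup>2) > 0\<close> in simp)
        then show ?thesis using xJ[of i] by simp
      qed
      have "k * (norm (x m - x n))\<^sup>2 \<le> 2 * (J (x m) - d) + 2 * (J (x n) - d)"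
        by (rule dist_bound[OF xW xW])
      also have "\<dots> < 2 * (k * e\<^sup>2 / 4) + 2 * (k * e\<^sup>2 / 4)"
        using inv[OF mn(1)] inv[OF mn(2)] by (intro add_strict_mono) simp_all
      finally have "k * (norm (x m - x n))\<^sup>2 < k * e\<^sup>2" by simp
      then have "(norm (x m - x n))\<^sup>2 < e\<^sup>2" using k by simp
      then show "dist (x m) (x n) < e"
        using \<open>e > 0\<close> by (simp add: dist_norm power2_less_imp_less)
    qed
  qed
  then obtain u where lim: "x \<longlonglongrightarrow> u" using Cauchy_convergent convergentD by blast
  have uW: "u \<in> W" using closed_sequentially[OF W(2) xW lim] .
  have "(\<lambda>n. J (x n)) \<longlonglongrightarrow> J u"
    unfolding J_def by (intro tendsto_intros b.tendsto \<phi>.tendsto lim)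
  moreover have "(\<lambda>n. d + inverse (real (Suc n))) \<longlonglongrightarrow> d + 0"
    by (intro tendsto_intros LIMSEQ_inverse_real_of_nat)
  ultimately have "J u \<le> d + 0"
    by (rule LIMSEQ_le) (use xJ less_imp_le in blast)
  then have Ju: "J u \<le> d" by simp
  show ?thesis
  proof (intro bexI[OF _ uW] ballI)
    fix v assume v: "v \<in> W"
    have "2 * t * (b u v - \<phi> v) + t\<^sup>2 * b v v \<ge> 0" for t
    proof -
      have "J (u + t *\<^sub>R v) \<ge> J u"
        using d_le[of "u + t *\<^sub>R v"] Ju uW v W(1) by (simp add: subspace_add subspace_scale)
      then show ?thesis
        by (simp add: J_def b.add_left b.add_right b.scaleR_left b.scaleR_right \<phi>.add \<phi>.scaleR
            sym[of v u] power2_eq_square algebra_simps)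
    qed
    then show "b u v = \<phi> v" using quadratic_nonneg_imp_linear_zero by fastforce
  qed
qed

lemma subspace_closure:
  fixes S :: "'a::real_normed_vector set"
  assumes S: "subspace S"
  shows "subspace (closure S)"
proof (rule subspaceI)
  show "0 \<in> closure S" using S closure_subset subspace_0 by blast
  show "x + y \<in> closure S" if xy: "x \<in> closure S" "y \<in> closure S" for x y
  proof -
    obtain f where f: "\<And>n. f n \<in> S" "f \<longlonglongrightarrow> x"
      using iffD1[OF closure_sequential xy(1)] by blast
    obtain g where g: "\<And>n. g n \<in> S" "g \<longlonglongrightarrow> y"
      using iffD1[OF closure_sequential xy(2)] by blast
    have "\<forall>n. f n + g n \<in> S" using f(1) g(1) subspace_add[OF S] by simp
    moreover have "(\<lambda>n. f n + g n) \<longlonglongrightarrow> x + y" by (rule tendsto_add[OF f(2) g(2)])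
    ultimately show ?thesis unfolding closure_sequential by (intro exI conjI)
  qed
  show "c *\<^sub>R x \<in> closure S" if x: "x \<in> closure S" for c x
  proof -
    obtain f where f: "\<And>n. f n \<in> S" "f \<longlonglongrightarrow> x"
      using iffD1[OF closure_sequential x] by blast
    have "\<forall>n. c *\<^sub>R f n \<in> S" using f(1) subspace_scale[OF S] by simp
    moreover have "(\<lambda>n. c *\<^sub>R f n) \<longlonglongrightarrow> c *\<^sub>R x"
      by (rule tendsto_scaleR[OF tendsto_const f(2)])
    ultimately show ?thesis unfolding closure_sequential by (intro exI conjI)
  qed
qed

lemma orthogonal_projection_exists:
  fixes S :: "'h::{real_inner,banach} set"
  assumes "subspace S" "closed S"
  shows "\<exists>y\<in>S. \<forall>z\<in>S. (x - y) \<bullet> z = 0"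
proof -
  have "\<exists>y\<in>S. \<forall>z\<in>S. y \<bullet> z = x \<bullet> z"
    by (rule coercive_form_represents_functional[where k=1])
      (auto simp: assms inner_commute power2_norm_eq_inner
        intro: bounded_bilinear_inner bounded_linear_inner_right)
  then obtain y where y: "y \<in> S" "\<And>z. z \<in> S \<Longrightarrow> y \<bullet> z = x \<bullet> z" by blast
  then show ?thesis by (intro bexI[OF _ y(1)]) (simp add: inner_diff_left)
qed

lemma subspace_dense_if_orthogonal_trivial:
  fixes S X :: "'h::{real_inner,banach} set"
  assumes S: "subspace S" and SX: "S \<subseteq> X" and X: "subspace X" "closed X"
    and trivial: "\<And>x. x \<in> X \<Longrightarrow> (\<And>z. z \<in> S \<Longrightarrow> x \<bullet> z = 0) \<Longrightarrow> x = 0"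
  shows "closure S = X"
proof
  show sub: "closure S \<subseteq> X" using SX X(2) by (rule closure_minimal)
  show "X \<subseteq> closure S"
  proof
    fix x assume x: "x \<in> X"
    obtain y where y: "y \<in> closure S" "\<And>z. z \<in> closure S \<Longrightarrow> (x - y) \<bullet> z = 0"
      using orthogonal_projection_exists[OF subspace_closure[OF S] closed_closure, of x] by blast
    have "x - y = 0"
      using x y sub X(1) closure_subset[of S]
      by (intro trivial) (auto intro: subspace_diff)
    then show "x \<in> closure S" using y(1) by simp
  qed
qed

section \<open>Solution operators of the form and their Galerkin approximation\<close>

text \<open>
  The form problem in real terms: \<open>b\<close> stands for the real part of the given form. As the
  Galerkin spaces are complex subspaces, testing with all real multiples and with \<open>\<i>\<close> times the test
  functions recovers the complex equations from the real ones, so nothing is lost.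
\<close>

locale galerkin_form =
  fixes j :: "'v::{real_inner,banach} \<Rightarrow> 'h::{real_inner,banach}"
    and b :: "'v \<Rightarrow> 'v \<Rightarrow> real" and k K :: real
  assumes j: "bounded_linear j"
    and b: "bounded_bilinear b" and b_sym: "\<And>u v. b u v = b v u"
    and k: "k > 0" and coercive: "\<And>u. k * (norm u)\<^sup>2 \<le> b u u"
    and K: "\<And>u v. b u v \<le> K * norm u * norm v"
begin

sublocale j: bounded_linear j by (rule j)
sublocale b: bounded_bilinear b by (rule b)

text \<open>
  \<open>sol W f\<close> is the Galerkin solution in \<open>W\<close> of the equation with right-hand side \<open>f\<close>, and
  \<open>sol_op W\<close> is its version on the pivot space: \<open>sol_op UNIV\<close> is \<open>A\<^sup>-\<^sup>1\<close>, and \<open>sol_op (V m)\<close> is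
  \<open>A\<^sub>m\<^sup>-\<^sup>1 P\<^sub>m\<close>. Since the Galerkin approximation of \<open>sol UNIV f\<close> is \<open>sol W f\<close>, the error of the
  Ritz projection on the range of \<open>sol UNIV\<close> is \<open>err W\<close>.
\<close>

definition sol :: "'v set \<Rightarrow> 'h \<Rightarrow> 'v" where
  "sol W f = (SOME u. u \<in> W \<and> (\<forall>v\<in>W. b u v = f \<bullet> j v))"

definition sol_op :: "'v set \<Rightarrow> 'h \<Rightarrow> 'h" where
  "sol_op W f = j (sol W f)"

definition err :: "'v set \<Rightarrow> 'h \<Rightarrow> 'v" where
  "err W f = sol UNIV f - sol W f"

context
  fixes W :: "'v set" assumes W: "subspace W" "closed W"
begin

lemma sol_exists: "sol W f \<in> W \<and> (\<forall>v\<in>W. b (sol W f) v = f \<bullet> j v)"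
  unfolding sol_def
proof (rule someI_ex)
  have "bounded_linear (\<lambda>v. f \<bullet> j v)"
    by (intro bounded_linear_compose[OF bounded_linear_inner_right j])
  from coercive_form_represents_functional[OF b b_sym k coercive W this]
  show "\<exists>u. u \<in> W \<and> (\<forall>v\<in>W. b u v = f \<bullet> j v)" by blast
qed

lemma sol_in: "sol W f \<in> W" using sol_exists by blast
lemma sol_eq: "v \<in> W \<Longrightarrow> b (sol W f) v = f \<bullet> j v" using sol_exists by blast

lemma sol_unique:
  assumes "u \<in> W" and "\<And>v. v \<in> W \<Longrightarrow> b u v = f \<bullet> j v"
  shows "u = sol W f"
proof -
  have "u - sol W f \<in> W" using assms(1) sol_in W(1) by (simp add: subspace_diff)
  then have "b (u - sol W f) (u - sol W f) = 0"
    using assms(2) sol_eq by (simp add: b.diff_left)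
  then have "k * (norm (u - sol W f))\<^sup>2 \<le> 0" using coercive[of "u - sol W f"] by simp
  then show ?thesis using k by (simp add: mult_le_0_iff)
qed

lemma sol_add: "sol W (f + g) = sol W f + sol W g"
  by (rule sol_unique[symmetric])
    (auto simp: sol_in sol_eq b.add_left inner_add_left intro: subspace_add[OF W(1)])

lemma sol_scaleR: "sol W (c *\<^sub>R f) = c *\<^sub>R sol W f"
  by (rule sol_unique[symmetric])
    (auto simp: sol_in sol_eq b.scaleR_left intro: subspace_scale[OF W(1)])

lemma norm_sol_le:
  assumes "N \<ge> 0" and N: "\<And>v. norm (j v) \<le> norm v * N"
  shows "norm (sol W f) \<le> norm f * (N / k)"
proof (cases "sol W f = 0")
  case False
  have "k * (norm (sol W f))\<^sup>2 \<le> f \<bullet> j (sol W f)"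
    using coercive[of "sol W f"] sol_eq[OF sol_in] by simp
  also have "\<dots> \<le> norm f * (norm (sol W f) * N)"
    using norm_cauchy_schwarz[of f "j (sol W f)"] N[of "sol W f"]
    by (meson dual_order.trans mult_left_mono norm_ge_zero)
  finally have "norm (sol W f) * (k * norm (sol W f)) \<le> norm (sol W f) * (norm f * N)"
    by (simp add: power2_eq_square algebra_simps)
  then have "k * norm (sol W f) \<le> norm f * N" using False by simp
  then show ?thesis using k by (simp add: field_simps)
qed (use \<open>N \<ge> 0\<close> k in simp)

lemma bounded_linear_sol: "bounded_linear (sol W)"
proof -
  obtain N where "N > 0" and N: "\<And>v. norm (j v) \<le> norm v * N" using j.pos_bounded by blast
  show ?thesis
    by (rule bounded_linear_intro[OF sol_add sol_scaleR norm_sol_le[OF _ N]])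
      (use \<open>N > 0\<close> in simp)
qed

lemma bounded_linear_sol_op: "bounded_linear (sol_op W)"
  unfolding sol_op_def by (intro bounded_linear_compose[OF j] bounded_linear_sol)

lemma inner_sol_op: "f \<bullet> sol_op W g = b (sol W f) (sol W g)"
  unfolding sol_op_def by (simp add: sol_eq sol_in)

lemma sol_op_symmetric: "sol_op W f \<bullet> g = f \<bullet> sol_op W g"
  using inner_sol_op[of f g] inner_sol_op[of g f] b_sym inner_commute by metis

text \<open>
  Coercivity in the stronger norm yields a spectral gap in the pivot space: this is
  \<open>(A x | x) \<ge> \<delta> |x|\<^sup>2\<close> for \<open>x = A\<^sup>-\<^sup>1 f\<close>.
\<close>

lemma sol_op_dissipative:
  assumes "N > 0" and N: "\<And>v. norm (j v) \<le> norm v * N"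
  shows "k / N\<^sup>2 * (norm (sol_op W f))\<^sup>2 \<le> f \<bullet> sol_op W f"
proof -
  have "(norm (sol_op W f))\<^sup>2 \<le> (norm (sol W f) * N)\<^sup>2"
    unfolding sol_op_def by (intro power_mono N) simp
  then have "k / N\<^sup>2 * (norm (sol_op W f))\<^sup>2 \<le> k / N\<^sup>2 * (norm (sol W f) * N)\<^sup>2"
    using k by (intro mult_left_mono) auto
  also have "\<dots> = k * (norm (sol W f))\<^sup>2" using \<open>N > 0\<close> by (simp add: power_mult_distrib)
  also have "\<dots> \<le> f \<bullet> sol_op W f" unfolding inner_sol_op by (rule coercive)
  finally show ?thesis .
qed

lemma subspace_image: "subspace (j ` W)"
  by (rule linear_subspace_image[OF bounded_linear.linear[OF j] W(1)])

lemma sol_op_in: "sol_op W f \<in> closure (j ` W)"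
  unfolding sol_op_def using sol_in closure_subset by blast

lemma orthogonal_image_eq_0:
  assumes "x \<in> closure (j ` W)" and "\<And>v. v \<in> W \<Longrightarrow> x \<bullet> j v = 0"
  shows "x = 0"
proof -
  have "closure (j ` W) \<subseteq> {z. x \<bullet> z = 0}"
    by (rule closure_minimal) (auto simp: assms(2) intro: closed_hyperplane)
  then show ?thesis using assms(1) by (auto simp: inner_eq_zero_iff)
qed

text \<open>
  Density of the operator domain. A vector \<open>x\<close> orthogonal to the range is in particular orthogonal
  to its own image, so the energy of \<open>sol W x\<close> vanishes; hence \<open>x\<close> is orthogonal to \<open>j ` W\<close>.
\<close>

lemma range_sol_op_dense:
  "closure (sol_op W ` closure (j ` W)) = closure (j ` W)"
proof (rule subspace_dense_if_orthogonal_trivial)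
  have "subspace (closure (j ` W))" by (rule subspace_closure[OF subspace_image])
  then show "subspace (closure (j ` W))" "subspace (sol_op W ` closure (j ` W))"
    by (auto intro: linear_subspace_image bounded_linear.linear bounded_linear_sol_op)
  show "sol_op W ` closure (j ` W) \<subseteq> closure (j ` W)" using sol_op_in by blast
  fix x assume x: "x \<in> closure (j ` W)" "\<And>z. z \<in> sol_op W ` closure (j ` W) \<Longrightarrow> x \<bullet> z = 0"
  then have "b (sol W x) (sol W x) = 0" by (simp add: inner_sol_op[symmetric])
  then have "k * (norm (sol W x))\<^sup>2 \<le> 0" using coercive[of "sol W x"] by simp
  then have "sol W x = 0" using k by (simp add: mult_le_0_iff)
  then have "x \<bullet> j v = 0" if "v \<in> W" for v using sol_eq[OF that, of x] by (simp add: b.zero_left)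
  then show "x = 0" using orthogonal_image_eq_0 x(1) by blast
qed simp

text \<open>
  The Galerkin equations see a right-hand side only through its products with \<open>j ` W\<close>, which is why
  no projection has to be written in front of the argument of \<open>sol_op W\<close>.
\<close>

lemma sol_op_cong_orthogonal:
  assumes "\<And>z. z \<in> closure (j ` W) \<Longrightarrow> (x - y) \<bullet> z = 0"
  shows "sol_op W x = sol_op W y"
proof -
  have "(x - y) \<bullet> j v = 0" if "v \<in> W" for v using assms closure_subset that by blast
  then have "sol W x = sol W y"
    by (intro sol_unique sol_in) (auto simp: sol_eq inner_diff_left)
  then show ?thesis by (simp add: sol_op_def)
qed

end

lemma UNIV_subspace: "subspace (UNIV :: 'v set)" "closed (UNIV :: 'v set)" by auto

context
  fixes W :: "'v set" assumes W: "subspace W" "closed W"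
begin

lemma galerkin_orthogonality: "v \<in> W \<Longrightarrow> b (err W f) v = 0"
  using sol_eq[OF UNIV_subspace, of v f] sol_eq[OF W, of v f] by (simp add: err_def b.diff_left)

text \<open>
  Cea's lemma: by Galerkin orthogonality the energy of the error does not change when the Galerkin
  solution in its second argument is replaced by any element of \<open>W\<close>.
\<close>

lemma cea:
  assumes "K \<ge> 0"
  shows "norm (err W f) \<le> K / k * infdist (sol UNIV f) W"
proof -
  have "norm (err W f) * (k / K) \<le> infdist (sol UNIV f) W" if "K > 0" "err W f \<noteq> 0"
  proof -
    have "norm (err W f) * (k / K) \<le> dist (sol UNIV f) v" if v: "v \<in> W" for v
    proof -
      have "sol W f - v \<in> W" using v sol_in[OF W] W(1) by (simp add: subspace_diff)
      then have "b (err W f) (err W f) = b (err W f) (sol UNIV f - v)"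
        using galerkin_orthogonality[of "sol W f - v" f] by (simp add: err_def b.diff_right)
      then have "norm (err W f) * (k * norm (err W f)) \<le> norm (err W f) * (K * norm (sol UNIV f - v))"
        using K[of "err W f" "sol UNIV f - v"] coercive[of "err W f"]
        by (simp add: power2_eq_square mult_ac)
      then show ?thesis
        using \<open>err W f \<noteq> 0\<close> \<open>K > 0\<close> by (simp add: dist_norm field_simps)
    qed
    moreover have "W \<noteq> {}" using W(1) subspace_0 by blast
    ultimately show ?thesis by (simp add: infdist_notempty cINF_greatest)
  qed
  moreover have "err W f = 0" if "K = 0"
  proof -
    have "k * (norm (err W f))\<^sup>2 \<le> 0"
      using K[of "err W f" "err W f"] coercive[of "err W f"] that by simp
    then show ?thesis using k by (simp add: mult_le_0_iff)
  qed
  ultimately show ?thesis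
    using assms k by (cases "K = 0"; cases "err W f = 0") (auto simp: field_simps infdist_nonneg)
qed

text \<open>
  Symmetry turns the error tested against \<open>\<phi>\<close> into the energy pairing of the error for \<open>f\<close> with
  the error of the dual problem for \<open>\<phi>\<close>: Galerkin orthogonality may be used in both arguments.
\<close>

lemma inner_error: "(sol_op UNIV f - sol_op W f) \<bullet> \<phi> = b (err W f) (err W \<phi>)"
proof -
  have "(sol_op UNIV f - sol_op W f) \<bullet> \<phi> = \<phi> \<bullet> j (err W f)"
    by (simp add: sol_op_def err_def j.diff inner_commute)
  also have "\<dots> = b (err W f) (sol UNIV \<phi>)"
    using sol_eq[OF UNIV_subspace, of "err W f" \<phi>] b_sym by simp
  also have "\<dots> = b (err W f) (err W \<phi>)"
    using galerkin_orthogonality[OF sol_in[OF W], of f \<phi>] by (simp add: err_def b.diff_right)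
  finally show ?thesis .
qed

text \<open>
  The duality argument of Aubin and Nitsche: in \<open>inner_error\<close> take for \<open>\<phi>\<close> the error itself.
\<close>

lemma aubin_nitsche:
  assumes "K \<ge> 0" and c: "\<And>\<phi>. norm (err W \<phi>) \<le> c * norm \<phi>"
  shows "norm (sol_op UNIV f - sol_op W f) \<le> K * c * norm (err W f)"
proof -
  let ?D = "sol_op UNIV f - sol_op W f"
  have "(norm ?D)\<^sup>2 = b (err W f) (err W ?D)" by (simp add: power2_norm_eq_inner inner_error)
  also have "\<dots> \<le> K * norm (err W f) * norm (err W ?D)" by (rule K)
  also have "\<dots> \<le> K * norm (err W f) * (c * norm ?D)"
    using \<open>K \<ge> 0\<close> by (intro mult_left_mono c) auto
  finally have "norm ?D * norm ?D \<le> (K * c * norm (err W f)) * norm ?D"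
    by (simp add: power2_eq_square mult_ac)
  then show ?thesis
  proof (cases "?D = 0")
    case True
    have "0 \<le> c * norm f" using c[of f] norm_ge_zero order_trans by blast
    then have "err W f = 0 \<or> c \<ge> 0" using c[of f] by (cases "f = 0") (auto simp: zero_le_mult_iff)
    then show ?thesis using True \<open>K \<ge> 0\<close> by auto
  qed simp
qed

end
end

section \<open>The uniform boundedness principle\<close>

text \<open>
  The Banach-Steinhaus theorem, from Baire's theorem in the complete space \<open>X\<close>: one of the sets of
  points at which all \<open>F n\<close> are bounded by \<open>N\<close> contains a ball of \<open>X\<close>, and translating this
  ball to the origin costs a factor 2. It is stated for maps that are linear on \<open>X\<close> only, since
  the Galerkin semigroups are unconstrained outside of their spaces.
\<close>

lemma uniform_boundedness_on_closed_subspace: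
  fixes F :: "nat \<Rightarrow> 'a::{real_normed_vector,complete_space} \<Rightarrow> 'b::real_normed_vector"
  assumes X: "subspace X" "closed X"
    and add: "\<And>n x y. x \<in> X \<Longrightarrow> y \<in> X \<Longrightarrow> F n (x + y) = F n x + F n y"
    and scale: "\<And>n c x. x \<in> X \<Longrightarrow> F n (c *\<^sub>R x) = c *\<^sub>R F n x"
    and bounded: "\<And>n. \<exists>C. \<forall>x\<in>X. norm (F n x) \<le> C * norm x"
    and pointwise: "\<And>x. x \<in> X \<Longrightarrow> \<exists>C. \<forall>n. norm (F n x) \<le> C"
  shows "\<exists>C. \<forall>n. \<forall>x\<in>X. norm (F n x) \<le> C * norm x"
proof -
  define S where "S N = {x \<in> X. \<forall>n. norm (F n x) \<le> real N}" for N :: nat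
  have cont: "continuous_on X (F n)" for n
  proof -
    obtain C where C: "\<And>x. x \<in> X \<Longrightarrow> norm (F n x) \<le> C * norm x" using bounded by blast
    have diff: "F n x - F n y = F n (x - y)" if "x \<in> X" "y \<in> X" for x y
      using add[of "x - y" y n] that X(1) by (simp add: subspace_diff)
    have "norm (F n x - F n y) \<le> \<bar>C\<bar> * norm (x - y)" if "x \<in> X" "y \<in> X" for x y
    proof -
      have "norm (F n (x - y)) \<le> C * norm (x - y)" using C that X(1) subspace_diff by blast
      also have "\<dots> \<le> \<bar>C\<bar> * norm (x - y)" by (intro mult_right_mono) auto
      finally show ?thesis using diff[OF that] by simp
    qed
    then have "\<bar>C\<bar>-lipschitz_on X (F n)"
      by (intro lipschitz_onI) (auto simp: dist_norm)
    then show ?thesis by (rule lipschitz_on_continuous_on)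
  qed
  have "closedin (top_of_set X) (S N)" for N
  proof -
    have "closedin (top_of_set X) {x \<in> X. norm (F n x) \<in> {..real N}}" for n
      using continuous_closedin_preimage[OF continuous_on_norm[OF cont], of "{..real N}" n]
      by (simp add: vimage_def Collect_conj_eq)
    then have "closedin (top_of_set X) (\<Inter>n. {x \<in> X. norm (F n x) \<in> {..real N}})"
      by (intro closedin_Inter) auto
    moreover have "(\<Inter>n. {x \<in> X. norm (F n x) \<in> {..real N}}) = S N" by (auto simp: S_def)
    ultimately show ?thesis by simp
  qed
  moreover have "X \<subseteq> \<Union> (range S)"
  proof
    fix x assume x: "x \<in> X"
    obtain C where C: "\<And>n. norm (F n x) \<le> C" using pointwise[OF x] by blast
    obtain N where "C \<le> real N" using real_arch_simple by blast
    then show "x \<in> \<Union> (range S)" using x C by (auto simp: S_def intro: order_trans)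
  qed
  then have "\<Union> (range S) = X" by (auto simp: S_def)
  moreover have "completely_metrizable_space (top_of_set X)"
    using X(2) by (intro completely_metrizable_space_closedin completely_metrizable_space_euclidean)
      (simp add: closed_closedin[symmetric])
  moreover have "top_of_set X interior_of X \<noteq> {}"
    using subspace_0[OF X(1)] interior_of_topspace[of "top_of_set X"] by auto
  ultimately obtain N where "top_of_set X interior_of (S N) \<noteq> {}"
    using Baire_category_alt[of "top_of_set X" "range S"] by force
  then obtain x0 where x0: "x0 \<in> top_of_set X interior_of (S N)" by blast
  have "openin (top_of_set X) (top_of_set X interior_of (S N))" by simp
  then obtain r where r: "r > 0"
    and rS: "\<And>y. y \<in> X \<Longrightarrow> dist y x0 < r \<Longrightarrow> y \<in> top_of_set X interior_of (S N)"
    using x0 unfolding openin_euclidean_subtopology_iff by blast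
  have rS: "norm (F n y) \<le> real N" if "y \<in> X" "dist y x0 < r" for n y
    using rS[OF that] interior_of_subset[of "top_of_set X" "S N"] by (auto simp: S_def)
  have x0X: "x0 \<in> X" using x0 interior_of_subset[of "top_of_set X" "S N"] by (auto simp: S_def)
  have "norm (F n x) \<le> (4 * real N / r) * norm x" if x: "x \<in> X" for n x
  proof (cases "x = 0")
    case True
    then show ?thesis using scale[OF x, of n 0] by simp
  next
    case False
    \<comment> \<open>shifted by \<open>c x\<close>, the centre \<open>x0\<close> stays inside of the ball of radius \<open>r\<close>\<close>
    define c where "c = r / (2 * norm x)"
    have c: "c > 0" using r False by (simp add: c_def)
    have y: "x0 + c *\<^sub>R x \<in> X" using x0X x X(1) by (simp add: subspace_add subspace_scale)
    have "dist (x0 + c *\<^sub>R x) x0 = r / 2" using r False by (simp add: dist_norm c_def)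
    then have "norm (F n (x0 + c *\<^sub>R x)) \<le> real N" "norm (F n x0) \<le> real N"
      using rS y x0X r by auto
    moreover have "F n (x0 + c *\<^sub>R x) = F n x0 + c *\<^sub>R F n x"
      using add x0X scale x X(1) by (simp add: subspace_scale)
    ultimately have "norm (c *\<^sub>R F n x) \<le> 2 * real N"
      using norm_triangle_ineq4[of "F n x0 + c *\<^sub>R F n x" "F n x0"] by simp
    then have "c * norm (F n x) \<le> 2 * real N" using c by simp
    then show ?thesis using r False by (simp add: c_def field_simps)
  qed
  then show ?thesis by blast
qed

section \<open>Semigroups with positive self-adjoint generator\<close>

lemma le_of_real_derivative_le:
  fixes f :: "real \<Rightarrow> real"
  assumes "a \<le> b" and cont: "continuous_on {a..b} f"
    and deriv: "\<And>x. a < x \<Longrightarrow> x < b \<Longrightarrow> (f has_real_derivative f' x) (at x)"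
    and bound: "\<And>x. a < x \<Longrightarrow> x < b \<Longrightarrow> f' x \<le> c"
  shows "f b \<le> f a + c * (b - a)"
proof -
  have "f a - c * a \<ge> f b - c * b"
  proof (rule DERIV_nonpos_imp_decreasing_open[OF \<open>a \<le> b\<close>])
    fix x assume x: "a < x" "x < b"
    have "((\<lambda>x. f x - c * x) has_real_derivative (f' x - c)) (at x)"
      using DERIV_diff[OF deriv[OF x] DERIV_cmult_Id[of c]] by simp
    then show "\<exists>y. ((\<lambda>x. f x - c * x) has_real_derivative y) (at x) \<and> y \<le> 0"
      using bound[OF x] by force
  qed (intro continuous_intros cont)
  then show ?thesis by (simp add: algebra_simps)
qed

text \<open>
  A semigroup on \<open>X\<close> generated by the negative of a positive self-adjoint operator \<open>A \<ge> \<delta>\<close>,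
  which is given through its bounded inverse \<open>G = A\<^sup>-\<^sup>1\<close>. Writing elements of the domain as \<open>G f\<close>
  replaces the unbounded operator by \<open>f\<close> itself. As \<open>G\<close> is total, \<open>A\<^sub>m\<^sup>-\<^sup>1 P\<^sub>m\<close> fits in
  as well.
\<close>

locale inverse_semigroup =
  fixes X :: "'h::complex_hilbert set" and G :: "'h \<Rightarrow> 'h" and \<delta> :: real
    and T :: "real \<Rightarrow> 'h \<Rightarrow> 'h"
  assumes X: "subspace X" "closed X"
    and G: "bounded_linear G" and G_in: "\<And>f. f \<in> X \<Longrightarrow> G f \<in> X"
    and G_sym: "\<And>f g. G f \<bullet> g = f \<bullet> G g"
    and \<delta>: "\<delta> > 0" and G_dissipative: "\<And>f. \<delta> * (norm (G f))\<^sup>2 \<le> f \<bullet> G f"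
    and G_dense: "closure (G ` X) = X"
    and generated: "generated_by_neg X T {(G f, f) | f. f \<in> X}"
begin

sublocale G: bounded_linear G by (rule G)

lemma C0: "C0_semigroup X T" and gen: "generator X T = {(G f, - f) | f. f \<in> X}"
  using generated by (auto simp: generated_by_neg_def)

lemma T_in: "t \<ge> 0 \<Longrightarrow> x \<in> X \<Longrightarrow> T t x \<in> X"
  and T_add: "t \<ge> 0 \<Longrightarrow> x \<in> X \<Longrightarrow> y \<in> X \<Longrightarrow> T t (x + y) = T t x + T t y"
  and T_scaleR: "t \<ge> 0 \<Longrightarrow> x \<in> X \<Longrightarrow> T t (c *\<^sub>R x) = c *\<^sub>R T t x"
  and T_bounded: "t \<ge> 0 \<Longrightarrow> \<exists>C. \<forall>x\<in>X. norm (T t x) \<le> C * norm x"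
  and T_0: "x \<in> X \<Longrightarrow> T 0 x = x"
  and T_plus: "r \<ge> 0 \<Longrightarrow> t \<ge> 0 \<Longrightarrow> x \<in> X \<Longrightarrow> T (r + t) x = T r (T t x)"
  and T_right: "x \<in> X \<Longrightarrow> ((\<lambda>t. T t x) \<longlongrightarrow> x) (at_right 0)"
  using C0 by (auto simp: C0_semigroup_def bounded_clinear_on_def scaleR_scaleC image_subset_iff)

lemma T_diff: "t \<ge> 0 \<Longrightarrow> x \<in> X \<Longrightarrow> y \<in> X \<Longrightarrow> T t (x - y) = T t x - T t y"
  using T_add[of t "x - y" y] X(1) by (simp add: subspace_diff)

lemma T_minus: "t \<ge> 0 \<Longrightarrow> x \<in> X \<Longrightarrow> T t (- x) = - T t x"
  using T_scaleR[of t x "-1"] by simp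

lemma X_closed_ops:
  "x \<in> X \<Longrightarrow> y \<in> X \<Longrightarrow> x + y \<in> X" "x \<in> X \<Longrightarrow> y \<in> X \<Longrightarrow> x - y \<in> X"
  "x \<in> X \<Longrightarrow> - x \<in> X" "x \<in> X \<Longrightarrow> c *\<^sub>R x \<in> X" "0 \<in> X"
  using X(1) by (auto simp: subspace_def subspace_diff subspace_neg)

lemma T_tendsto:
  assumes "t \<ge> 0" "\<And>i. z i \<in> X" "x \<in> X" "(z \<longlongrightarrow> x) F"
  shows "((\<lambda>i. T t (z i)) \<longlongrightarrow> T t x) F"
proof -
  obtain C where C: "\<And>x. x \<in> X \<Longrightarrow> norm (T t x) \<le> C * norm x" using T_bounded assms(1) by blast
  have "((\<lambda>i. C * norm (z i - x)) \<longlongrightarrow> 0) F"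
    by (rule tendsto_mult_right_zero, rule tendsto_norm_zero) (use assms(4) LIM_zero in blast)
  moreover have "norm (T t (z i) - T t x) \<le> C * norm (z i - x)" for i
    using C[of "z i - x"] assms X_closed_ops by (simp add: T_diff)
  ultimately have "((\<lambda>i. T t (z i) - T t x) \<longlongrightarrow> 0) F"
    by (rule Lim_null_comparison[OF always_eventually[OF allI], rotated])
  then show ?thesis by (rule LIM_zero_cancel)
qed

lemma generator_quotient:
  assumes "f \<in> X"
  shows "((\<lambda>h. (1 / h) *\<^sub>R (T h (G f) - G f)) \<longlongrightarrow> - f) (at_right 0)"
proof -
  have "(G f, - f) \<in> generator X T" using assms gen by blast
  then show ?thesis by (simp add: generator_def)
qed

text \<open>
  The semigroup preserves the domain of its generator and commutes with it: the difference quotients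
  of \<open>T t (G f)\<close> are the images under \<open>T t\<close> of those of \<open>G f\<close>.
\<close>

lemma T_G:
  assumes t: "t \<ge> 0" and f: "f \<in> X"
  shows "T t (G f) = G (T t f)"
proof -
  \<comment> \<open>negative \<open>h\<close> are truncated to 0, since \<open>T h\<close> is specified for \<open>h \<ge> 0\<close> only\<close>
  have "((\<lambda>h. T t ((1 / max h 0) *\<^sub>R (T (max h 0) (G f) - G f))) \<longlongrightarrow> T t (- f)) (at_right 0)"
  proof (rule T_tendsto[OF t])
    show "(1 / max h 0) *\<^sub>R (T (max h 0) (G f) - G f) \<in> X" for h :: real
      by (intro X_closed_ops T_in G_in f) auto
    show "((\<lambda>h. (1 / max h 0) *\<^sub>R (T (max h 0) (G f) - G f)) \<longlongrightarrow> - f) (at_right 0)"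
      by (rule Lim_transform_eventually[OF generator_quotient[OF f]],
          rule eventually_mono[OF eventually_at_right_less]) simp
  qed (use f X_closed_ops in auto)
  moreover have "\<forall>\<^sub>F h in at_right 0. T t ((1 / max h 0) *\<^sub>R (T (max h 0) (G f) - G f))
      = (1 / h) *\<^sub>R (T h (T t (G f)) - T t (G f))"
  proof (rule eventually_mono[OF eventually_at_right_less])
    fix h :: real assume h: "0 < h"
    have "T h (T t (G f)) = T t (T h (G f))"
      using T_plus[of h t "G f"] T_plus[of t h "G f"] h t G_in[OF f] by (simp add: add.commute)
    then show "T t ((1 / max h 0) *\<^sub>R (T (max h 0) (G f) - G f))
      = (1 / h) *\<^sub>R (T h (T t (G f)) - T t (G f))"
      using h t f by (simp add: T_scaleR T_diff T_in G_in X_closed_ops)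
  qed
  ultimately have "((\<lambda>h. (1 / h) *\<^sub>R (T h (T t (G f)) - T t (G f))) \<longlongrightarrow> T t (- f)) (at_right 0)"
    by (rule Lim_transform_eventually)
  then have "(T t (G f), T t (- f)) \<in> generator X T"
    using t f by (simp add: generator_def T_in G_in X_closed_ops)
  then obtain g where "T t (G f) = G g" "T t (- f) = - g" unfolding gen by blast
  then show ?thesis using T_minus[OF t f] by simp
qed

lemma T_continuous_at_0:
  assumes "x \<in> X" shows "((\<lambda>t. T t x) \<longlongrightarrow> x) (at 0 within {0..})"
  using T_right[OF assms] by (simp add: at_within_Ici_at_right)

text \<open>
  The definition of a semigroup gives a bound for each single time. If no common bound existed near
  0, there would be times tending to 0 along which the operators are unbounded although
  they converge pointwise, against the uniform boundedness principle. The common bound is what gives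
  control of orbits to the left of a given time.
\<close>

lemma T_bounded_near_0:
  "\<exists>d>0. \<exists>M. \<forall>t\<in>{0..d}. \<forall>x\<in>X. norm (T t x) \<le> M * norm x"
proof (rule ccontr)
  assume contr: "\<not> ?thesis"
  have "\<exists>t\<in>{0..inverse (real (Suc n))}. \<exists>x\<in>X. norm (T t x) > real n * norm x" for n
  proof (rule ccontr)
    assume "\<not> ?thesis"
    then have "\<forall>t\<in>{0..inverse (real (Suc n))}. \<forall>x\<in>X. norm (T t x) \<le> real n * norm x"
      by (auto simp: not_less)
    moreover have "inverse (real (Suc n)) > 0" by simp
    ultimately show False using contr by blast
  qed
  then obtain \<tau> where \<tau>: "\<And>n. \<tau> n \<in> {0..inverse (real (Suc n))}"
    and ex: "\<And>n. \<exists>x\<in>X. norm (T (\<tau> n) x) > real n * norm x" by metis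
  have \<tau>_nonneg: "\<tau> n \<ge> 0" for n using \<tau>[of n] by auto
  have \<tau>_lim: "\<tau> \<longlonglongrightarrow> 0"
    by (rule tendsto_sandwich[OF _ _ tendsto_const LIMSEQ_inverse_real_of_nat])
      (use \<tau> in \<open>auto intro!: always_eventually\<close>)
  have "\<exists>C. \<forall>n. \<forall>x\<in>X. norm (T (\<tau> n) x) \<le> C * norm x"
  proof (rule uniform_boundedness_on_closed_subspace[OF X])
    fix x assume x: "x \<in> X"
    have "continuous (at 0 within {0..}) (\<lambda>t. T t x)"
      using T_continuous_at_0[OF x] T_0[OF x] by (simp add: continuous_within)
    then have "(\<lambda>n. T (\<tau> n) x) \<longlonglongrightarrow> T 0 x"
      by (rule continuous_within_tendsto_compose'[OF _ _ \<tau>_lim]) (use \<tau>_nonneg in auto)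
    then have "Bseq (\<lambda>n. T (\<tau> n) x)" by (rule convergent_imp_Bseq[OF convergentI])
    then show "\<exists>C. \<forall>n. norm (T (\<tau> n) x) \<le> C" by (auto simp: Bseq_def)
  qed (use \<tau>_nonneg T_add T_scaleR T_bounded in auto)
  then obtain C where C: "\<And>n x. x \<in> X \<Longrightarrow> norm (T (\<tau> n) x) \<le> C * norm x" by blast
  obtain n where "C \<le> real n" using real_arch_simple by blast
  obtain x where "x \<in> X" "norm (T (\<tau> n) x) > real n * norm x" using ex by blast
  then show False using C[of x n] mult_right_mono[OF \<open>C \<le> real n\<close>, of "norm x"] by simp
qed

text \<open>
  Times slightly before \<open>t\<close> are a fixed time plus a time near 0.
\<close>

lemma T_bounded_nearby:
  assumes t: "t \<ge> 0"
  shows "\<exists>d>0. \<exists>C\<ge>0. \<forall>r\<ge>0. \<bar>r - t\<bar> \<le> d \<longrightarrow> r \<le> t \<longrightarrow> (\<forall>x\<in>X. norm (T r x) \<le> C * norm x)"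
proof -
  obtain d M where d: "d > 0" and M: "\<And>t x. t \<in> {0..d} \<Longrightarrow> x \<in> X \<Longrightarrow> norm (T t x) \<le> M * norm x"
    using T_bounded_near_0 by blast
  define t0 where "t0 = max 0 (t - d)"
  obtain C where C: "\<And>x. x \<in> X \<Longrightarrow> norm (T t0 x) \<le> C * norm x"
    using T_bounded[of t0] by (auto simp: t0_def)
  have "norm (T r x) \<le> \<bar>C\<bar> * \<bar>M\<bar> * norm x" if r: "r \<ge> 0" "\<bar>r - t\<bar> \<le> d" "r \<le> t" and x: "x \<in> X" for r x
  proof -
    have r0: "r - t0 \<in> {0..d}" using r t by (auto simp: t0_def)
    have "norm (T r x) = norm (T t0 (T (r - t0) x))"
      using T_plus[of t0 "r - t0" x] r0 x by (simp add: t0_def)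
    also have "\<dots> \<le> C * norm (T (r - t0) x)" using r0 x by (intro C T_in) auto
    also have "\<dots> \<le> \<bar>C\<bar> * norm (T (r - t0) x)" by (intro mult_right_mono) auto
    also have "\<dots> \<le> \<bar>C\<bar> * (M * norm x)" by (intro mult_left_mono M r0 x) auto
    also have "\<dots> \<le> \<bar>C\<bar> * (\<bar>M\<bar> * norm x)" by (intro mult_left_mono mult_right_mono) auto
    finally show ?thesis by (simp add: mult_ac)
  qed
  then show ?thesis using d by (intro exI[of _ d] conjI exI[of _ "\<bar>C\<bar> * \<bar>M\<bar>"]) auto
qed

lemma T_continuous:
  assumes x: "x \<in> X"
  shows "continuous_on {0..} (\<lambda>t. T t x)"
  unfolding continuous_on_eq_continuous_within
proof
  fix t :: real assume "t \<in> {0..}"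
  then have t: "t \<ge> 0" by simp
  obtain d C where d: "d > 0" and "C \<ge> 0" and C: "\<And>r x. r \<ge> 0 \<Longrightarrow> \<bar>r - t\<bar> \<le> d \<Longrightarrow> r \<le> t \<Longrightarrow> x \<in> X
      \<Longrightarrow> norm (T r x) \<le> C * norm x"
    using T_bounded_nearby[OF t] by metis
  \<comment> \<open>both directions reduce to times near 0; from the left, the operator in front varies with \<open>r\<close>\<close>
  have bound: "norm (T r x - T t x) \<le> C * norm (T \<bar>r - t\<bar> x - x)" if r: "r \<ge> 0" "\<bar>r - t\<bar> \<le> d" for r
  proof (cases "r \<ge> t")
    case True
    then have "T r x - T t x = T t (T \<bar>r - t\<bar> x - x)"
      using T_plus[of t "r - t" x] t x by (simp add: T_diff T_in)
    then show ?thesis using C[of t "T \<bar>r - t\<bar> x - x"] t d x by (simp add: T_in X_closed_ops)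
  next
    case False
    then have "T t x - T r x = T r (T \<bar>r - t\<bar> x - x)"
      using T_plus[of r "t - r" x] r x by (simp add: T_diff T_in)
    then have "norm (T r x - T t x) = norm (T r (T \<bar>r - t\<bar> x - x))"
      by (metis norm_minus_commute)
    then show ?thesis using C[of r "T \<bar>r - t\<bar> x - x"] r False x by (simp add: T_in X_closed_ops)
  qed
  have abs_lim: "((\<lambda>r. \<bar>r - t\<bar>) \<longlongrightarrow> 0) (at t within {0..})"
    by (rule tendsto_eq_intros | simp)+
  have "((\<lambda>h. T h x) \<longlongrightarrow> x) (at 0 within {0..})" by (rule T_continuous_at_0[OF x])
  then have "((\<lambda>r. T \<bar>r - t\<bar> x) \<longlongrightarrow> x) (at t within {0..})"
    by (rule filterlim_compose)
      (auto simp: filterlim_at abs_lim eventually_at intro!: exI[of _ 1])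
  then have "((\<lambda>r. C * norm (T \<bar>r - t\<bar> x - x)) \<longlongrightarrow> C * norm (x - x)) (at t within {0..})"
    by (intro tendsto_intros)
  then have lim0: "((\<lambda>r. C * norm (T \<bar>r - t\<bar> x - x)) \<longlongrightarrow> 0) (at t within {0..})" by simp
  have "((\<lambda>r. T r x - T t x) \<longlongrightarrow> 0) (at t within {0..})"
  proof (rule Lim_null_comparison[OF _ lim0])
    show "\<forall>\<^sub>F r in at t within {0..}. norm (T r x - T t x) \<le> C * norm (T \<bar>r - t\<bar> x - x)"
      unfolding eventually_at
      by (intro exI[of _ d] conjI d ballI impI bound) (auto simp: dist_real_def)
  qed
  then show "continuous (at t within {0..}) (\<lambda>t. T t x)"
    unfolding continuous_within by (rule LIM_zero_cancel)
qed

text \<open>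
  The generator only controls right derivatives at 0. For \<open>r\<close> on either side of \<open>t\<close>, the
  remainder of the first order expansion is the operator at the smaller of the two times, applied
  to the remainder at 0 (and, from the left, to the oscillation of the orbit of \<open>f\<close>).
\<close>

lemma T_has_derivative:
  assumes f: "f \<in> X" and t: "t > 0"
  shows "((\<lambda>t. T t (G f)) has_vector_derivative - T t f) (at t)"
proof -
  obtain d C where d: "d > 0" and "C \<ge> 0" and C: "\<And>r x. r \<ge> 0 \<Longrightarrow> \<bar>r - t\<bar> \<le> d \<Longrightarrow> r \<le> t \<Longrightarrow> x \<in> X
      \<Longrightarrow> norm (T r x) \<le> C * norm x"
    using T_bounded_nearby[of t] t by (metis less_imp_le)
  define x where "x = G f"
  have x: "x \<in> X" using f G_in by (simp add: x_def)
  define q where "q h = norm ((1/h) *\<^sub>R (T h x - x) + f) + norm (T h f - f)" for h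
  have bound: "norm (T r x - T t x + (r - t) *\<^sub>R T t f) \<le> \<bar>r - t\<bar> * (C * q \<bar>r - t\<bar>)"
    if r: "r \<ge> 0" "\<bar>r - t\<bar> \<le> d" "r \<noteq> t" for r
  proof (cases "r > t")
    case True
    define h where "h = r - t"
    have h: "h > 0" "\<bar>r - t\<bar> = h" "r = t + h" using True by (auto simp: h_def)
    have "T r x - T t x + (r - t) *\<^sub>R T t f = h *\<^sub>R T t ((1/h) *\<^sub>R (T h x - x) + f)"
      using T_plus[of t h x] t x f h
      by (simp add: T_diff T_in T_add T_scaleR X_closed_ops scaleR_add_right)
    also have "norm \<dots> = h * norm (T t ((1/h) *\<^sub>R (T h x - x) + f))" using h by simp
    also have "\<dots> \<le> h * (C * norm ((1/h) *\<^sub>R (T h x - x) + f))"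
      using h t d x f by (intro mult_left_mono C) (auto simp: T_in X_closed_ops)
    also have "\<dots> \<le> h * (C * q h)"
      using h \<open>C \<ge> 0\<close> by (intro mult_left_mono) (auto simp: q_def)
    finally show ?thesis using h by simp
  next
    case False
    define h where "h = t - r"
    have h: "h > 0" "\<bar>r - t\<bar> = h" "t = r + h" "r \<le> t" using False r by (auto simp: h_def)
    have "T r x - T t x + (r - t) *\<^sub>R T t f
      = - (h *\<^sub>R T r (((1/h) *\<^sub>R (T h x - x) + f) + (T h f - f)))"
      using T_plus[of r h x] T_plus[of r h f] r x f h
      by (simp add: T_diff T_in T_add T_scaleR X_closed_ops scaleR_add_right scaleR_diff_right)
    also have "norm \<dots> = h * norm (T r (((1/h) *\<^sub>R (T h x - x) + f) + (T h f - f)))" using h by simp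
    also have "\<dots> \<le> h * (C * norm (((1/h) *\<^sub>R (T h x - x) + f) + (T h f - f)))"
      using h r x f by (intro mult_left_mono C) (auto simp: T_in X_closed_ops)
    also have "\<dots> \<le> h * (C * q h)"
      using h \<open>C \<ge> 0\<close> unfolding q_def by (intro mult_left_mono norm_triangle_ineq) auto
    finally show ?thesis using h by simp
  qed
  have "((\<lambda>h. (1/h) *\<^sub>R (T h x - x)) \<longlongrightarrow> - f) (at_right 0)"
    unfolding x_def by (rule generator_quotient[OF f])
  then have "(q \<longlongrightarrow> norm (- f + f) + norm (f - f)) (at_right 0)"
    unfolding q_def[abs_def] by (intro tendsto_intros T_right[OF f])
  then have q0: "(q \<longlongrightarrow> 0) (at_right 0)" by simp
  have abs_lim: "((\<lambda>r. \<bar>r - t\<bar>) \<longlongrightarrow> 0) (at t)"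
    by (rule tendsto_eq_intros | simp)+
  have "filterlim (\<lambda>r. \<bar>r - t\<bar>) (at_right 0) (at t)"
    by (auto simp: filterlim_at abs_lim eventually_at intro!: exI[of _ 1])
  from filterlim_compose[OF q0 this] have "((\<lambda>r. C * q \<bar>r - t\<bar>) \<longlongrightarrow> C * 0) (at t)"
    by (intro tendsto_intros)
  then have lim0: "((\<lambda>r. C * q \<bar>r - t\<bar>) \<longlongrightarrow> 0) (at t)" by simp
  have "((\<lambda>r. (1 / norm (r - t)) *\<^sub>R (T r x - (T t x + (r - t) *\<^sub>R - T t f))) \<longlongrightarrow> 0) (at t)"
  proof (rule Lim_null_comparison[OF _ lim0])
    show "\<forall>\<^sub>F r in at t. norm ((1 / norm (r - t)) *\<^sub>R (T r x - (T t x + (r - t) *\<^sub>R - T t f)))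
      \<le> C * q \<bar>r - t\<bar>"
      unfolding eventually_at
    proof (intro exI[of _ "min d t"] conjI ballI impI)
      fix r assume r: "r \<noteq> t \<and> dist r t < min d t"
      then have "r \<ge> 0" "\<bar>r - t\<bar> \<le> d" "r \<noteq> t" "\<bar>r - t\<bar> > 0" by (auto simp: dist_real_def)
      from bound[OF this(1-3)] this(4)
      show "norm ((1 / norm (r - t)) *\<^sub>R (T r x - (T t x + (r - t) *\<^sub>R - T t f))) \<le> C * q \<bar>r - t\<bar>"
        by (simp add: divide_simps mult_ac diff_add_eq_diff_diff_swap[symmetric] add_diff_eq diff_diff_eq2 diff_add_eq)
    qed (use d t in auto)
  qed
  then show ?thesis
    unfolding has_vector_derivative_def has_derivative_within x_def
    by (simp add: bounded_linear_scaleR_left bounded_linear_minus)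
qed

text \<open>
  Operators on \<open>X\<close> are compared by differentiating orbits, which is possible on the domain; every
  such statement passes to limits.
\<close>

lemma G_density_induct [consumes 1, case_names image limit]:
  assumes "x \<in> X"
    and image: "\<And>f. f \<in> X \<Longrightarrow> P (G f)"
    and limit: "\<And>z x. (\<And>n. z n \<in> X) \<Longrightarrow> (\<And>n. P (z n)) \<Longrightarrow> x \<in> X \<Longrightarrow> z \<longlonglongrightarrow> x \<Longrightarrow> P x"
  shows "P x"
proof -
  have "x \<in> closure (G ` X)" using assms(1) G_dense by simp
  then obtain z where z: "\<And>n. z n \<in> G ` X" "z \<longlonglongrightarrow> x"
    using closure_sequential[of x "G ` X"] by blast
  have "z n \<in> X \<and> P (z n)" for n using z(1)[of n] G_in image by auto
  then show ?thesis using z(2) assms(1) limit by blast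
qed

text \<open>
  On the domain, \<open>(d/dt) |u|\<^sup>2 = - 2 (A u | u) \<le> - 2 \<delta> |u|\<^sup>2\<close> for \<open>u = T(t) G f\<close>; the estimate extends to
  the whole space by density.
\<close>

lemma norm_T_le:
  assumes t: "t \<ge> 0" and x: "x \<in> X"
  shows "norm (T t x) \<le> exp (- \<delta> * t) * norm x"
  using x
proof (induction rule: G_density_induct)
  case (image f)
  define \<phi> where "\<phi> t = exp (2 * \<delta> * t) * (T t (G f) \<bullet> T t (G f))" for t
  have "\<phi> t \<le> \<phi> 0 + 0 * (t - 0)"
  proof (rule le_of_real_derivative_le[OF t])
    show "continuous_on {0..t} \<phi>" unfolding \<phi>_def
      by (intro continuous_intros continuous_on_subset[OF T_continuous] G_in image) auto
    fix r assume r: "0 < r" "r < t"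
    have "((\<lambda>t. T t (G f) \<bullet> T t (G f)) has_real_derivative
       (T r (G f) \<bullet> - T r f + - T r f \<bullet> T r (G f))) (at r)"
      unfolding has_real_derivative_iff_has_vector_derivative
      by (rule bounded_bilinear.has_vector_derivative[OF bounded_bilinear_inner]
          T_has_derivative image r)+
    then show "(\<phi> has_real_derivative 
        exp (2 * \<delta> * r) * (2 * (\<delta> * (norm (T r (G f)))\<^sup>2 - T r f \<bullet> T r (G f)))) (at r)"
      unfolding \<phi>_def
      by (auto intro!: derivative_eq_intros simp: power2_norm_eq_inner inner_commute algebra_simps)
    have "\<delta> * (norm (T r (G f)))\<^sup>2 \<le> T r f \<bullet> T r (G f)"
      using G_dissipative[of "T r f"] T_G[of r f] r image by simp
    then show "exp (2 * \<delta> * r) * (2 * (\<delta> * (norm (T r (G f)))\<^sup>2 - T r f \<bullet> T r (G f))) \<le> 0"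
      by (simp add: mult_le_0_iff)
  qed
  then have "exp (2 * \<delta> * t) * (norm (T t (G f)))\<^sup>2 \<le> (norm (G f))\<^sup>2"
    by (simp add: \<phi>_def T_0 image G_in power2_norm_eq_inner)
  then have "(exp (\<delta> * t) * norm (T t (G f)))\<^sup>2 \<le> (norm (G f))\<^sup>2"
    by (simp add: power_mult_distrib exp_double[symmetric] mult.assoc)
  then have "exp (\<delta> * t) * norm (T t (G f)) \<le> norm (G f)"
    by (rule power2_le_imp_le) simp
  then show ?case by (simp add: exp_minus field_simps)
next
  case (limit z x)
  have "(\<lambda>n. norm (T t (z n))) \<longlonglongrightarrow> norm (T t x)"
    by (intro tendsto_norm T_tendsto t limit)
  moreover have "(\<lambda>n. exp (- \<delta> * t) * norm (z n)) \<longlonglongrightarrow> exp (- \<delta> * t) * norm x"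
    by (intro tendsto_intros limit)
  ultimately show ?case by (rule LIMSEQ_le) (use limit.IH in auto)
qed

lemma T_contractive: "t \<ge> 0 \<Longrightarrow> x \<in> X \<Longrightarrow> norm (T t x) \<le> norm x"
  using norm_T_le[of t x] \<delta> mult_right_mono[of "exp (- \<delta> * t)" 1 "norm x"]
  by (simp add: order_trans)

text \<open>
  For \<open>x\<close> and \<open>y\<close> in the domain, \<open>(T(r) x | T(t - r) y)\<close> does not depend on \<open>r\<close>, by
  symmetry of the generator; compare the values at \<open>r = t\<close> and \<open>r = 0\<close>.
\<close>

lemma T_symmetric:
  assumes t: "t \<ge> 0" and x: "x \<in> X" and y: "y \<in> X"
  shows "T t x \<bullet> y = x \<bullet> T t y"
proof -
  have *: "T t (G f) \<bullet> G g = G f \<bullet> T t (G g)" if fg: "f \<in> X" "g \<in> X" for f g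
  proof (cases "t = 0")
    case False
    then have "0 < t" using t by simp
    define \<psi> where "\<psi> r = T r (G f) \<bullet> T (t - r) (G g)" for r
    have "\<psi> t = \<psi> 0"
    proof (rule DERIV_isconst_end[OF \<open>0 < t\<close>])
      have "continuous_on {0..t} ((\<lambda>r. T r (G g)) \<circ> (\<lambda>r. t - r))"
        by (intro continuous_on_compose continuous_intros continuous_on_subset[OF T_continuous]
            G_in fg) auto
      then show "continuous_on {0..t} \<psi>" unfolding \<psi>_def o_def
        by (intro continuous_intros continuous_on_subset[OF T_continuous] G_in fg) auto
      fix r assume r: "0 < r" "r < t"
      have "((\<lambda>r. t - r) has_vector_derivative - 1) (at r)"
        by (auto intro!: derivative_eq_intros simp: has_real_derivative_iff_has_vector_derivative[symmetric])
      moreover have "((\<lambda>r. T r (G g)) has_vector_derivative - T (t - r) g) (at (t - r))"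
        using T_has_derivative fg r by simp
      ultimately have "(((\<lambda>r. T r (G g)) \<circ> (\<lambda>r. t - r)) has_vector_derivative (- 1) *\<^sub>R - T (t - r) g) (at r)"
        by (rule vector_diff_chain_at)
      then have "((\<lambda>r. T (t - r) (G g)) has_vector_derivative T (t - r) g) (at r)"
        by (simp add: o_def)
      with T_has_derivative[OF fg(1) r(1)]
      have "(\<psi> has_real_derivative (T r (G f) \<bullet> T (t - r) g + - T r f \<bullet> T (t - r) (G g))) (at r)"
        unfolding \<psi>_def has_real_derivative_iff_has_vector_derivative
        by (rule bounded_bilinear.has_vector_derivative[OF bounded_bilinear_inner])
      then show "DERIV \<psi> r :> 0"
        using r fg by (simp add: T_G G_sym)
    qed
    then show ?thesis by (simp add: \<psi>_def T_0 G_in fg)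
  qed (simp add: T_0 G_in fg)
  have **: "T t x \<bullet> G g = x \<bullet> T t (G g)" if g: "g \<in> X" for g
    using x
  proof (induction rule: G_density_induct)
    case (limit z x)
    have "(\<lambda>n. T t (z n) \<bullet> G g) \<longlonglongrightarrow> T t x \<bullet> G g"
      by (intro tendsto_intros T_tendsto t limit)
    moreover have "(\<lambda>n. z n \<bullet> T t (G g)) \<longlonglongrightarrow> x \<bullet> T t (G g)"
      by (intro tendsto_intros limit)
    ultimately show ?case using limit.IH LIMSEQ_unique by simp
  qed (rule *[OF _ g])
  show ?thesis using y
  proof (induction rule: G_density_induct)
    case (limit z y)
    have "(\<lambda>n. x \<bullet> T t (z n)) \<longlonglongrightarrow> x \<bullet> T t y"
      by (intro tendsto_intros T_tendsto t limit)
    moreover have "(\<lambda>n. T t x \<bullet> z n) \<longlonglongrightarrow> T t x \<bullet> y"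
      by (intro tendsto_intros limit)
    ultimately show ?case using limit.IH LIMSEQ_unique by simp
  qed (rule **)
qed

text \<open>
  The smoothing estimate \<open>t |A T(t) w| \<le> |w|\<close> for \<open>w = G (G f)\<close> in the domain of \<open>A\<^sup>2\<close>. With \<open>u = T(t) w\<close>,
  the functional \<open>F = |u|\<^sup>2 + 2 t (A u | u) + 2 t\<^sup>2 |A u|\<^sup>2\<close> is decreasing: all terms of its derivative
  cancel except for \<open>- 4 t\<^sup>2 (A\<^sup>2 u | A u)\<close>.
\<close>

lemma analyticity_bound:
  assumes t: "t \<ge> 0" and f: "f \<in> X"
  shows "t * norm (T t (G f)) \<le> norm (G (G f))"
proof -
  define F where "F r = T r (G (G f)) \<bullet> T r (G (G f)) + 2 * r * (T r (G f) \<bullet> T r (G (G f)))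
      + 2 * r\<^sup>2 * (T r (G f) \<bullet> T r (G f))" for r
  have Gf: "G f \<in> X" "G (G f) \<in> X" using f G_in by auto
  have "F t \<le> F 0 + 0 * (t - 0)"
  proof (rule le_of_real_derivative_le[OF t])
    show "continuous_on {0..t} F" unfolding F_def
      by (intro continuous_intros continuous_on_subset[OF T_continuous] Gf) auto
    fix r assume r: "0 < r" "r < t"
    let ?u = "T r (G (G f))" and ?v = "T r (G f)" and ?w = "T r f"
    note inner_deriv = bounded_bilinear.has_vector_derivative[OF bounded_bilinear_inner,
        folded has_real_derivative_iff_has_vector_derivative]
    note du = T_has_derivative[OF Gf(1) r(1)] and dv = T_has_derivative[OF f r(1)]
    have "(F has_real_derivative (?u \<bullet> - ?v + - ?v \<bullet> ?u)
       + (2 * (?v \<bullet> ?u) + 2 * r * (?v \<bullet> - ?v + - ?w \<bullet> ?u))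
       + (4 * r * (?v \<bullet> ?v) + 2 * r\<^sup>2 * (?v \<bullet> - ?w + - ?w \<bullet> ?v))) (at r)"
      unfolding F_def
      by (rule derivative_eq_intros inner_deriv[OF du du] inner_deriv[OF dv du]
          inner_deriv[OF dv dv] refl)+ (simp add: algebra_simps)
    moreover have "?w \<bullet> ?u = ?v \<bullet> ?v"
      using r f Gf by (simp add: T_G flip: G_sym)
    ultimately show "(F has_real_derivative - 4 * r\<^sup>2 * (?w \<bullet> ?v)) (at r)"
      by (simp add: inner_commute algebra_simps)
    have "0 \<le> \<delta> * (norm (G ?w))\<^sup>2" using \<delta> by simp
    also have "\<dots> \<le> ?w \<bullet> ?v" using G_dissipative[of ?w] r f by (simp add: T_G)
    finally show "- 4 * r\<^sup>2 * (?w \<bullet> ?v) \<le> 0" by simp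
  qed
  then have "F t \<le> (norm (G (G f)))\<^sup>2" by (simp add: F_def T_0 Gf power2_norm_eq_inner)
  moreover have "T t (G f) \<bullet> T t (G (G f)) \<ge> 0"
  proof -
    have "0 \<le> \<delta> * (norm (G (T t (G f))))\<^sup>2" using \<delta> by simp
    also have "\<dots> \<le> T t (G f) \<bullet> T t (G (G f))"
      using G_dissipative[of "T t (G f)"] t Gf by (simp add: T_G)
    finally show ?thesis .
  qed
  then have "2 * t * (T t (G f) \<bullet> T t (G (G f))) \<ge> 0" using t by simp
  moreover have "T t (G (G f)) \<bullet> T t (G (G f)) \<ge> 0" by simp
  ultimately have "2 * t\<^sup>2 * (T t (G f) \<bullet> T t (G f)) \<le> (norm (G (G f)))\<^sup>2"
    unfolding F_def by linarith
  then have "2 * (t * norm (T t (G f)))\<^sup>2 \<le> (norm (G (G f)))\<^sup>2"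
    by (simp add: power2_norm_eq_inner power_mult_distrib)
  then have "(t * norm (T t (G f)))\<^sup>2 \<le> (norm (G (G f)))\<^sup>2"
    using zero_le_power2[of "t * norm (T t (G f))"] by linarith
  then show ?thesis by (rule power2_le_imp_le) simp
qed

end

text \<open>
  The difference of the two orbits through a point of the domain solves the evolution equation with
  initial value 0, and its norm is decreasing since the generator is dissipative.
\<close>

lemma generated_semigroup_unique:
  assumes "inverse_semigroup X G \<delta> T" and "inverse_semigroup X G \<delta> S"
    and t: "t \<ge> 0" and x: "x \<in> X"
  shows "T t x = S t x"
proof -
  interpret T: inverse_semigroup X G \<delta> T by (rule assms(1))
  interpret S: inverse_semigroup X G \<delta> S by (rule assms(2))
  show ?thesis using x
  proof (induction rule: T.G_density_induct)
    case (image f)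
    define w where "w r = T r (G f) - S r (G f)" for r
    have "w t \<bullet> w t \<le> w 0 \<bullet> w 0 + 0 * (t - 0)"
    proof (rule le_of_real_derivative_le[OF t])
      show "continuous_on {0..t} (\<lambda>r. w r \<bullet> w r)" unfolding w_def
        by (intro continuous_intros continuous_on_subset[OF T.T_continuous]
            continuous_on_subset[OF S.T_continuous] T.G_in image) auto
      fix r assume r: "0 < r" "r < t"
      have "(w has_vector_derivative (- T r f - - S r f)) (at r)"
        unfolding w_def
        by (intro has_vector_derivative_diff T.T_has_derivative S.T_has_derivative image r)
      then show "((\<lambda>r. w r \<bullet> w r) has_real_derivative
          w r \<bullet> (- T r f - - S r f) + (- T r f - - S r f) \<bullet> w r) (at r)"
        unfolding has_real_derivative_iff_has_vector_derivative
        by (intro bounded_bilinear.has_vector_derivative[OF bounded_bilinear_inner])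
      have "0 \<le> \<delta> * (norm (G (T r f - S r f)))\<^sup>2" using T.\<delta> by simp
      also have "\<dots> \<le> (T r f - S r f) \<bullet> w r"
        using T.G_dissipative[of "T r f - S r f"] r image
        by (simp add: w_def T.T_G S.T_G T.G.diff)
      finally show "w r \<bullet> (- T r f - - S r f) + (- T r f - - S r f) \<bullet> w r \<le> 0"
        by (simp add: inner_commute inner_diff_left inner_diff_right)
    qed
    then have "w t \<bullet> w t \<le> 0" by (simp add: w_def T.T_0 S.T_0 T.G_in image)
    then have "w t = 0" by (metis inner_gt_zero_iff not_le)
    then show ?case by (simp add: w_def)
  next
    case (limit z x)
    have "(\<lambda>n. T t (z n)) \<longlonglongrightarrow> T t x" by (intro T.T_tendsto t limit)
    moreover have "(\<lambda>n. S t (z n)) \<longlonglongrightarrow> S t x" by (intro S.T_tendsto t limit)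
    ultimately show ?case using limit.IH LIMSEQ_unique by simp
  qed
qed

section \<open>Fractional powers\<close>

lemma powr_times_exp_decay_at_top:
  fixes s d :: real
  assumes "d > 0"
  shows "((\<lambda>t. t powr s * exp (- d * t)) \<longlongrightarrow> 0) at_top"
proof -
  have "((\<lambda>t::real. s * (ln t / t) - d) \<longlongrightarrow> s * 0 - d) at_top"
    by (intro tendsto_intros ln_x_over_x_tendsto_0)
  then have "LIM t at_top. (s * (ln t / t) - d) * t :> at_bot"
    by (rule filterlim_tendsto_neg_mult_at_bot) (use assms in \<open>auto intro: filterlim_ident\<close>)
  then have "((\<lambda>t. exp ((s * (ln t / t) - d) * t)) \<longlongrightarrow> 0) at_top"
    by (rule filterlim_compose[OF exp_at_bot])
  then show ?thesis
  proof (rule Lim_transform_eventually)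
    show "\<forall>\<^sub>F t in at_top. exp ((s * (ln t / t) - d) * t) = t powr s * exp (- d * t)"
      using eventually_gt_at_top[of 0]
      by eventually_elim (simp add: powr_def exp_add[symmetric] algebra_simps)
  qed
qed

lemma integrable_powr_times_exp:
  fixes s d :: real
  assumes "s > 0" "d > 0"
  shows "integrable lborel (\<lambda>t. indicator {0<..} t * (t powr (s - 1) * exp (- d * t)))"
proof -
  let ?g = "\<lambda>t. indicator {0<..} t * (t powr (s - 1) * exp (- d * t))"
  have "set_integrable lebesgue {0<..} (\<lambda>t. complex_of_real t powr (of_real s - 1) / of_real (exp (d * t)))"
    by (rule absolutely_integrable_Gamma_integral) (use assms in auto)
  then have "integrable lebesgue (\<lambda>t. norm (indicator {0<..} t *\<^sub>R
      (complex_of_real t powr (of_real s - 1) / of_real (exp (d * t)))))"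
    unfolding set_integrable_def by (rule integrable_norm)
  moreover have "norm (indicator {0<..} t *\<^sub>R
      (complex_of_real t powr (of_real s - 1) / of_real (exp (d * t)))) = ?g t" for t
  proof (cases "t > 0")
    case True
    have "complex_of_real t powr (of_real s - 1) = of_real (t powr (s - 1))"
      using powr_of_real[of t "s - 1"] True by simp
    then show ?thesis using True
      by (simp only: of_real_divide[symmetric] norm_scaleR norm_of_real)
        (simp add: indicator_def exp_minus divide_inverse abs_mult)
  qed simp
  ultimately have "integrable lebesgue ?g" by (simp only:)
  then show ?thesis by (subst (asm) integrable_completion) simp_all
qed

locale stable_semigroup = inverse_semigroup UNIV G \<delta> T
  for G :: "'h::{complex_hilbert, second_countable_topology} \<Rightarrow> 'h" and \<delta> T
begin

lemma T_bounded_linear: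
  assumes "t \<ge> 0" shows "bounded_linear (T t)"
proof -
  obtain C where "\<And>x. norm (T t x) \<le> C * norm x" using T_bounded[OF assms] by blast
  then show ?thesis
    by (intro bounded_linear_intro[of _ C]) (auto simp: T_add T_scaleR assms mult.commute)
qed

text \<open>
  \<open>neg_power s\<close> is \<open>A\<^sup>-\<^sup>s\<close>, and \<open>neg_power_bound s\<close> bounds its norm by means of the exponential decay
  of the semigroup.
\<close>

definition neg_power :: "real \<Rightarrow> 'h \<Rightarrow> 'h" where
  "neg_power s y = (\<integral>t. indicator {0<..} t *\<^sub>R (t powr (s - 1) / Gamma s) *\<^sub>R T t y \<partial>lborel)"

definition neg_power_bound :: "real \<Rightarrow> real" where
  "neg_power_bound s = (\<integral>t. indicator {0<..} t * (t powr (s - 1) * exp (- \<delta> * t)) \<partial>lborel) / Gamma s"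

context
  fixes s :: real assumes s: "s > 0"
begin

lemma Gamma_pos: "Gamma s > 0" using s by (rule Gamma_real_pos)

lemma norm_integrand_le:
  "norm (indicator {0<..} t *\<^sub>R (t powr (s - 1) / Gamma s) *\<^sub>R T t y)
     \<le> indicator {0<..} t * (t powr (s - 1) * exp (- \<delta> * t)) * (norm y / Gamma s)"
proof (cases "t > 0")
  case True
  have "t powr (s - 1) / Gamma s * norm (T t y)
      \<le> t powr (s - 1) / Gamma s * (exp (- \<delta> * t) * norm y)"
    by (intro mult_left_mono norm_T_le) (use True Gamma_pos in auto)
  then show ?thesis using True Gamma_pos by (simp add: field_simps)
qed simp

lemma integrable_integrand:
  "integrable lborel (\<lambda>t. indicator {0<..} t *\<^sub>R (t powr (s - 1) / Gamma s) *\<^sub>R T t y)"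
proof (rule Bochner_Integration.integrable_bound)
  show "integrable lborel (\<lambda>t. indicator {0<..} t * (t powr (s - 1) * exp (- \<delta> * t)) * (norm y / Gamma s))"
    using integrable_powr_times_exp[OF s \<delta>] by (rule integrable_mult_left)
  have "continuous_on {0<..} (\<lambda>t. (t powr (s - 1) / Gamma s) *\<^sub>R T t y)"
    using Gamma_pos by (intro continuous_intros continuous_on_subset[OF T_continuous]) auto
  from borel_measurable_continuous_on_indicator[of "{0<..}", OF _ this]
  show "(\<lambda>t. indicator {0<..} t *\<^sub>R (t powr (s - 1) / Gamma s) *\<^sub>R T t y) \<in> borel_measurable lborel"
    by (simp del: scaleR_scaleR)
  show "AE t in lborel. norm (indicator {0<..} t *\<^sub>R (t powr (s - 1) / Gamma s) *\<^sub>R T t y)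
      \<le> norm (indicator {0<..} t * (t powr (s - 1) * exp (- \<delta> * t)) * (norm y / Gamma s))"
    using Gamma_pos by (intro AE_I2 order_trans[OF norm_integrand_le]) simp
qed

lemma norm_neg_power_le: "norm (neg_power s y) \<le> neg_power_bound s * norm y"
proof -
  have "norm (neg_power s y)
      \<le> (\<integral>t. indicator {0<..} t * (t powr (s - 1) * exp (- \<delta> * t)) * (norm y / Gamma s) \<partial>lborel)"
    unfolding neg_power_def
    by (rule Bochner_Integration.integral_norm_bound_integral[OF integrable_integrand _ norm_integrand_le])
      (rule integrable_mult_left[OF integrable_powr_times_exp[OF s \<delta>]])
  also have "\<dots> = neg_power_bound s * norm y" by (simp add: neg_power_bound_def)
  finally show ?thesis .
qed

text \<open>
  Bounded operators may be moved through the Bochner integral. The choices of \<open>L\<close> are \<open>G\<close>, the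
  operators of the semigroup and the scalar multiplications.
\<close>

lemma neg_power_commute:
  assumes L: "bounded_linear L" and comm: "\<And>t. t > 0 \<Longrightarrow> L (T t y) = T t (L y)"
  shows "L (neg_power s y) = neg_power s (L y)"
proof -
  interpret L: bounded_linear L by (rule L)
  have "L (neg_power s y) = (\<integral>t. L (indicator {0<..} t *\<^sub>R (t powr (s - 1) / Gamma s) *\<^sub>R T t y) \<partial>lborel)"
    unfolding neg_power_def by (rule integral_bounded_linear[OF L integrable_integrand, symmetric])
  also have "\<dots> = neg_power s (L y)"
    unfolding neg_power_def
    by (intro Bochner_Integration.integral_cong refl) (auto simp: L.scaleR comm indicator_def L.zero)
  finally show ?thesis .
qed

lemma neg_power_G: "G (neg_power s y) = neg_power s (G y)"
  by (intro neg_power_commute G) (simp add: T_G)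

lemma neg_power_T: "r \<ge> 0 \<Longrightarrow> T r (neg_power s y) = neg_power s (T r y)"
  by (intro neg_power_commute T_bounded_linear)
    (simp_all add: T_plus[symmetric] add.commute)

lemma neg_power_diff: "neg_power s (x - y) = neg_power s x - neg_power s y"
proof -
  have "neg_power s (x - y) = (\<integral>t. indicator {0<..} t *\<^sub>R (t powr (s - 1) / Gamma s) *\<^sub>R T t x
      - indicator {0<..} t *\<^sub>R (t powr (s - 1) / Gamma s) *\<^sub>R T t y \<partial>lborel)"
    unfolding neg_power_def
    by (intro Bochner_Integration.integral_cong refl) (auto simp: indicator_def T_diff scaleR_diff_right)
  also have "\<dots> = neg_power s x - neg_power s y"
    unfolding neg_power_def by (intro Bochner_Integration.integral_diff integrable_integrand)
  finally show ?thesis .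
qed

lemma neg_power_scaleR: "neg_power s (c *\<^sub>R y) = c *\<^sub>R neg_power s y"
  by (rule neg_power_commute[OF bounded_linear_scaleR_right, symmetric]) (simp add: T_scaleR)

lemma neg_power_tendsto:
  assumes "(z \<longlongrightarrow> y) F"
  shows "((\<lambda>i. neg_power s (z i)) \<longlongrightarrow> neg_power s y) F"
proof -
  have "((\<lambda>i. neg_power_bound s * norm (z i - y)) \<longlongrightarrow> 0) F"
    by (rule tendsto_mult_right_zero, rule tendsto_norm_zero) (use assms LIM_zero in blast)
  moreover have "norm (neg_power s (z i) - neg_power s y) \<le> neg_power_bound s * norm (z i - y)" for i
    using norm_neg_power_le[of "z i - y"] by (simp add: neg_power_diff)
  ultimately have "((\<lambda>i. neg_power s (z i) - neg_power s y) \<longlongrightarrow> 0) F"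
    by (rule Lim_null_comparison[OF always_eventually[OF allI], rotated])
  then show ?thesis by (rule LIM_zero_cancel)
qed

text \<open>
  Symmetry and the semigroup law give \<open>(T(t) y | y) = |T(t/2) y|\<^sup>2\<close>, so \<open>(A\<^sup>-\<^sup>s y | y)\<close> is the integral
  of a nonnegative function. If it vanishes, so does \<open>T(t/2) y\<close> for almost every \<open>t > 0\<close>, which for
  small \<open>t\<close> contradicts strong continuity unless \<open>y = 0\<close>. Injectivity makes the power \<open>A\<^sup>s\<close> single-valued.
\<close>

lemma neg_power_injective:
  assumes "neg_power s y = 0"
  shows "y = 0"
proof (rule ccontr)
  assume "y \<noteq> 0"
  let ?g = "\<lambda>t. indicator {0<..} t * (t powr (s - 1) / Gamma s * (norm (T (t / 2) y))\<^sup>2)"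
  have inner_eq: "(indicator {0<..} t *\<^sub>R (t powr (s - 1) / Gamma s) *\<^sub>R T t y) \<bullet> y = ?g t" for t
  proof (cases "t > 0")
    case True
    then have "T t y \<bullet> y = T (t/2) y \<bullet> T (t/2) y"
      using T_plus[of "t/2" "t/2" y] T_symmetric[of "t/2" "T (t/2) y" y] by simp
    then show ?thesis using True by (simp add: power2_norm_eq_inner)
  qed simp
  have "integrable lborel (\<lambda>t. (indicator {0<..} t *\<^sub>R (t powr (s - 1) / Gamma s) *\<^sub>R T t y) \<bullet> y)"
    by (intro integrable_bounded_linear[OF bounded_linear_inner_left] integrable_integrand)
  then have int: "integrable lborel ?g" unfolding inner_eq .
  have "(\<integral>t. (indicator {0<..} t *\<^sub>R (t powr (s - 1) / Gamma s) *\<^sub>R T t y) \<bullet> y \<partial>lborel) = neg_power s y \<bullet> y"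
    unfolding neg_power_def
    by (intro integral_bounded_linear[OF bounded_linear_inner_left] integrable_integrand)
  then have "(\<integral>t. ?g t \<partial>lborel) = 0" unfolding inner_eq using assms by simp
  then have "AE t in lborel. ?g t = 0"
    using integral_nonneg_eq_0_iff_AE[OF int] Gamma_pos by (auto simp: indicator_def)
  then have null: "AE t in lborel. t > 0 \<longrightarrow> T (t / 2) y = 0"
    by (rule eventually_mono) (use Gamma_pos in \<open>auto simp: indicator_def split: if_splits\<close>)
  have "\<forall>\<^sub>F t in at_right 0. dist (T t y) y < norm y"
    using T_right[of y] \<open>y \<noteq> 0\<close> by (intro tendstoD) auto
  then obtain e where "e > 0" and e: "\<And>t. 0 < t \<Longrightarrow> t < e \<Longrightarrow> dist (T t y) y < norm y"
    unfolding eventually_at_right_field by auto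
  have "AE t in lborel. t \<notin> {0<..<2 * e}"
    using null
  proof (rule eventually_mono)
    fix t assume t: "t > 0 \<longrightarrow> T (t / 2) y = 0"
    show "t \<notin> {0<..<2 * e}"
    proof
      assume "t \<in> {0<..<2 * e}"
      then show False using t e[of "t/2"] by (simp add: dist_norm)
    qed
  qed
  then have "emeasure lborel {0<..<2 * e} = 0"
    by (subst (asm) AE_iff_measurable[of "{0<..<2 * e}"]) auto
  then show False using \<open>e > 0\<close> by simp
qed

text \<open>
  The exponent law \<open>A\<^sup>-\<^sup>1 A\<^sup>-\<^sup>s = A\<^bsup>-(s+1)\<^esup>\<close> is an integration by parts: the function
  \<open>t \<mapsto> t\<^sup>s T(t) G y\<close> vanishes at 0 and at infinity and has derivative
  \<open>s t\<^sup>s\<^sup>-\<^sup>1 T(t) G y - t\<^sup>s T(t) y\<close>. It is carried out after testing with a vector \<open>\<phi>\<close>, where the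
  fundamental theorem of calculus for real functions applies.
\<close>

lemma G_neg_power: "G (neg_power s y) = neg_power (s + 1) y"
proof -
  have G1: "Gamma (s + 1) = s * Gamma s"
    using s by (intro Gamma_plus1) (auto simp: nonpos_Ints_def)
  have s1: "s + 1 > 0" using s by simp
  have "(neg_power s (G y) - neg_power (s + 1) y) \<bullet> \<phi> = 0" for \<phi>
  proof -
    define F where "F t = t powr s * (T t (G y) \<bullet> \<phi>)" for t
    define f where "f t = s * t powr (s - 1) * (T t (G y) \<bullet> \<phi>) - t powr s * (T t y \<bullet> \<phi>)" for t
    let ?I = "\<lambda>t. indicator {0<..} t *\<^sub>R (t powr (s - 1) / Gamma s) *\<^sub>R T t (G y)
        - indicator {0<..} t *\<^sub>R (t powr (s + 1 - 1) / Gamma (s + 1)) *\<^sub>R T t y"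
    have I_eq: "?I t \<bullet> \<phi> = indicator {0<..} t * f t / Gamma (s + 1)" for t
    proof (cases "t > 0")
      case True
      have "?I t \<bullet> \<phi> = t powr (s - 1) / Gamma s * (T t (G y) \<bullet> \<phi>)
          - t powr s / (s * Gamma s) * (T t y \<bullet> \<phi>)"
        using True G1 G1[unfolded add.commute[of s]] by (simp add: inner_diff_left)
      also have "\<dots> = f t / (s * Gamma s)"
        using s Gamma_pos by (simp add: f_def diff_divide_distrib)
      finally show ?thesis using True G1 G1[unfolded add.commute[of s]] by simp
    qed simp
    have int: "integrable lborel ?I"
      by (intro Bochner_Integration.integrable_diff integrable_integrand
          stable_semigroup.integrable_integrand[OF stable_semigroup_axioms s1])
    have "neg_power s (G y) - neg_power (s + 1) y = (\<integral>t. ?I t \<partial>lborel)"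
      unfolding neg_power_def
      by (intro Bochner_Integration.integral_diff[symmetric] integrable_integrand
          stable_semigroup.integrable_integrand[OF stable_semigroup_axioms s1])
    then have "(neg_power s (G y) - neg_power (s + 1) y) \<bullet> \<phi> = (\<integral>t. ?I t \<bullet> \<phi> \<partial>lborel)"
      using integral_bounded_linear[OF bounded_linear_inner_left int, of \<phi>] by simp
    also have "\<dots> = (\<integral>t. indicator {0<..} t * f t \<partial>lborel) / Gamma (s + 1)"
      unfolding I_eq by simp
    also have "(\<integral>t. indicator {0<..} t * f t \<partial>lborel) = (LBINT t=0..\<infinity>. f t)"
      by (simp add: interval_lebesgue_integral_def set_lebesgue_integral_def zero_ereal_def)
    also have "\<dots> = 0 - 0"
    proof (rule interval_integral_FTC_integrable[where F = F])
      fix t :: real assume "0 < ereal t"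
      then have t: "t > 0" by simp
      have "((\<lambda>t. T t (G y) \<bullet> \<phi>) has_real_derivative - T t y \<bullet> \<phi>) (at t)"
        unfolding has_real_derivative_iff_has_vector_derivative
        by (intro bounded_linear.has_vector_derivative[OF bounded_linear_inner_left]
            T_has_derivative t) simp
      then show "(F has_vector_derivative f t) (at t)"
        unfolding has_real_derivative_iff_has_vector_derivative[symmetric] F_def f_def
        using t by (auto intro!: derivative_eq_intros simp: algebra_simps)
      have "continuous_on {0<..} f" unfolding f_def
        by (intro continuous_intros continuous_on_subset[OF T_continuous]) auto
      then show "isCont f t" using t by (simp add: continuous_on_eq_continuous_at)
    next
      have "integrable lborel (\<lambda>t. Gamma (s + 1) * (?I t \<bullet> \<phi>))"
        by (intro integrable_mult_right integrable_bounded_linear[OF bounded_linear_inner_left int])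
      then show "set_integrable lborel (einterval 0 \<infinity>) f"
        using Gamma_pos s unfolding I_eq by (simp add: set_integrable_def zero_ereal_def G1)
    next
      have F_bound: "norm (F t) \<le> (t powr s * exp (- \<delta> * t)) * (norm (G y) * norm \<phi>)" if "t > 0" for t
      proof -
        have "\<bar>T t (G y) \<bullet> \<phi>\<bar> \<le> norm (T t (G y)) * norm \<phi>" by (rule Cauchy_Schwarz_ineq2)
        also have "\<dots> \<le> exp (- \<delta> * t) * norm (G y) * norm \<phi>"
          using that by (intro mult_right_mono norm_T_le) auto
        finally have "t powr s * \<bar>T t (G y) \<bullet> \<phi>\<bar> \<le> t powr s * (exp (- \<delta> * t) * norm (G y) * norm \<phi>)"
          by (intro mult_left_mono) auto
        then show ?thesis by (simp add: F_def abs_mult mult_ac)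
      qed
      have "((\<lambda>t. t powr s * exp (- \<delta> * t) * (norm (G y) * norm \<phi>)) \<longlongrightarrow> 0) at_top"
        by (intro tendsto_mult_left_zero powr_times_exp_decay_at_top \<delta>)
      then have "(F \<longlongrightarrow> 0) at_top"
        by (rule Lim_null_comparison[rotated])
          (use F_bound in \<open>auto intro: eventually_mono[OF eventually_gt_at_top[of 0]]\<close>)
      then show "((F \<circ> real_of_ereal) \<longlongrightarrow> 0) (at_left \<infinity>)" by (simp add: ereal_tendsto_simps1)
      have ev: "\<forall>\<^sub>F t in at_right (0::real). 0 \<le> t"
        by (rule eventually_mono[OF eventually_at_right_less]) simp
      have "((\<lambda>t. t powr s * exp (- \<delta> * t) * (norm (G y) * norm \<phi>))
          \<longlongrightarrow> 0 powr s * exp (- \<delta> * 0) * (norm (G y) * norm \<phi>)) (at_right 0)"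
        using s ev by (intro tendsto_intros tendsto_powr'[OF tendsto_ident_at]) auto
      then have "((\<lambda>t. t powr s * exp (- \<delta> * t) * (norm (G y) * norm \<phi>)) \<longlongrightarrow> 0) (at_right 0)"
        by simp
      then have "(F \<longlongrightarrow> 0) (at_right 0)"
        by (rule Lim_null_comparison[rotated])
          (use F_bound in \<open>auto intro: eventually_mono[OF eventually_at_right_less]\<close>)
      then show "((F \<circ> real_of_ereal) \<longlongrightarrow> 0) (at_right 0)"
        by (simp add: ereal_tendsto_simps1 zero_ereal_def)
    qed simp
    finally show ?thesis by simp
  qed
  then have "neg_power s (G y) - neg_power (s + 1) y = 0"
    using inner_eq_zero_iff by blast
  then show ?thesis by (simp add: neg_power_G)
qed

text \<open>
  The existential quantifier over semigroups in the definition of the fractional power is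
  harmless, because the generator determines the semigroup.
\<close>

lemma frac_power_eq: "frac_power {(G f, f) | f. f \<in> UNIV} s = {(neg_power s y, y) | y. True}"
proof -
  have "x = neg_power s y" if T': "generated_by_neg UNIV T' {(G f, f) | f. f \<in> UNIV}"
    and int: "has_bochner_integral lborel
        (\<lambda>t. indicator {0<..} t *\<^sub>R (t powr (s - 1) / Gamma s) *\<^sub>R T' t y) x" for T' x y
  proof -
    have "inverse_semigroup UNIV G \<delta> T'"
      by (intro inverse_semigroup.intro X G G_in G_sym \<delta> G_dissipative G_dense T')
    then have "T' t y = T t y" if "t \<ge> 0" for t
      using generated_semigroup_unique[OF _ inverse_semigroup_axioms that] by simp
    then have "(\<lambda>t. indicator {0<..} t *\<^sub>R (t powr (s - 1) / Gamma s) *\<^sub>R T' t y)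
        = (\<lambda>t. indicator {0<..} t *\<^sub>R (t powr (s - 1) / Gamma s) *\<^sub>R T t y)"
      by (auto simp: indicator_def)
    then show ?thesis
      using int by (simp add: neg_power_def has_bochner_integral_integral_eq)
  qed
  moreover have "has_bochner_integral lborel
        (\<lambda>t. indicator {0<..} t *\<^sub>R (t powr (s - 1) / Gamma s) *\<^sub>R T t y) (neg_power s y)" for y
    unfolding neg_power_def by (rule has_bochner_integral_integrable[OF integrable_integrand])
  moreover have "generated_by_neg UNIV T {(G f, f) | f. f \<in> UNIV}" by (rule generated)
  ultimately show ?thesis unfolding frac_power_def by blast
qed

lemma op_apply_frac_power: "op_apply (frac_power {(G f, f) | f. f \<in> UNIV} s) (neg_power s y) = y"
  unfolding op_apply_def frac_power_eq
proof (rule the_equality)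
  fix z assume "(neg_power s y, z) \<in> {(neg_power s y, y) | y. True}"
  then have "neg_power s (z - y) = 0" by (simp add: neg_power_diff)
  then show "z = y" using neg_power_injective by fastforce
qed blast

end

end

section \<open>The error of the evolution problem\<close>

text \<open>
  An evolution and its approximation, tied together in the estimates below by the errors
  \<open>G f - Gm f\<close> of the stationary problem only.
\<close>

locale semigroup_pair =
  exact: inverse_semigroup UNIV G \<delta> T + approx: inverse_semigroup X Gm \<delta>m Tm
  for G :: "'h::complex_hilbert \<Rightarrow> 'h" and \<delta> T
    and X :: "'h set" and Gm :: "'h \<Rightarrow> 'h" and \<delta>m Tm
begin

text \<open>
  The heart of the proof. Let \<open>e\<close> be the difference of the approximate orbit through \<open>G\<^sub>m f\<close>
  and the exact orbit through \<open>G (G v)\<close>, and let \<open>\<rho> = (G\<^sub>m - G) T(t) G v\<close> be the error of the stationary problem along the exact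
  orbit. Applying \<open>G\<^sub>m\<close> to the evolution equation for \<open>e\<close> removes the unbounded operators and
  leaves the error equation \<open>G\<^sub>m e' + e = \<rho>\<close>. Since \<open>G\<^sub>m\<close> is symmetric and nonnegative, the functional
  \<open>\<Psi> = t |e|\<^sup>2 - 2 t (\<rho> | e) + 2 (G\<^sub>m e | e)\<close>
  satisfies
  \<open>\<Psi>' = 2 (\<rho> | e) - 3 |e|\<^sup>2 - 2 t (\<rho>' | e) - 2 t (G\<^sub>m e' | e') \<le> 4 M |e| - 3 |e|\<^sup>2 \<le> 4 M\<^sup>2\<close>
  as soon as \<open>|\<rho>|\<close> and \<open>t |\<rho>'|\<close> are bounded by \<open>M\<close>. The weight \<open>t\<close> is what admits initial
  errors: the initial value \<open>\<Psi>(0)\<close> only involves \<open>G\<^sub>m e(0)\<close>, which is small if \<open>G\<^sub>m f\<close> is close to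
  the projection \<open>p\<close> of the exact initial value, although \<open>e(0)\<close> itself is not.
\<close>

lemma error_energy_estimate:
  assumes f: "f \<in> X" and p: "p \<in> X" "Gm p = Gm (G (G v))" and t: "t > 0"
    and M1: "\<And>r. r \<ge> 0 \<Longrightarrow> norm (G (T r (G v)) - Gm (T r (G v))) \<le> M"
    and M2: "\<And>r. r \<ge> 0 \<Longrightarrow> r * norm (G (T r v) - Gm (T r v)) \<le> M"
  shows "(norm (Tm t (Gm f) - T t (G (G v))) - M)\<^sup>2
           \<le> 5 * M\<^sup>2 + 2 * ((Gm f - p) \<bullet> Gm (Gm f - p)) / t"
proof -
  define e where "e r = Tm r (Gm f) - T r (G (G v))" for r
  define e' where "e' r = T r (G v) - Tm r f" for r
  define \<rho> where "\<rho> r = Gm (T r (G v)) - G (T r (G v))" for r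
  define \<rho>' where "\<rho>' r = G (T r v) - Gm (T r v)" for r
  define \<Psi> where "\<Psi> r = r * (e r \<bullet> e r) - 2 * r * (\<rho> r \<bullet> e r) + 2 * (Gm (e r) \<bullet> e r)" for r
  have Gmf: "Gm f \<in> X" by (rule approx.G_in[OF f])
  have e_cont: "continuous_on {0..t} e" unfolding e_def
    by (intro continuous_intros continuous_on_subset[OF approx.T_continuous]
        continuous_on_subset[OF exact.T_continuous] Gmf) auto
  have \<rho>_cont: "continuous_on {0..t} \<rho>" unfolding \<rho>_def
    by (intro continuous_intros approx.G.continuous_on exact.G.continuous_on
        continuous_on_subset[OF exact.T_continuous]) auto
  have "\<Psi> t \<le> \<Psi> 0 + 4 * M\<^sup>2 * (t - 0)"
  proof (rule le_of_real_derivative_le)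
    show "continuous_on {0..t} \<Psi>" unfolding \<Psi>_def
      by (intro continuous_intros approx.G.continuous_on e_cont \<rho>_cont)
    fix r assume r: "0 < r" "r < t"
    note inner_deriv = bounded_bilinear.has_vector_derivative[OF bounded_bilinear_inner,
        folded has_real_derivative_iff_has_vector_derivative]
    have "(e has_vector_derivative - Tm r f - - T r (G v)) (at r)"
      unfolding e_def
      by (intro has_vector_derivative_diff approx.T_has_derivative exact.T_has_derivative f r) auto
    then have de: "(e has_vector_derivative e' r) (at r)" by (simp add: e'_def)
    have "(\<rho> has_vector_derivative Gm (- T r v) - G (- T r v)) (at r)"
      unfolding \<rho>_def
      by (intro has_vector_derivative_diff approx.G.has_vector_derivative
          exact.G.has_vector_derivative exact.T_has_derivative r) auto
    then have d\<rho>: "(\<rho> has_vector_derivative \<rho>' r) (at r)"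
      by (simp add: \<rho>'_def approx.G.neg exact.G.neg)
    have dGe: "((\<lambda>r. Gm (e r)) has_vector_derivative Gm (e' r)) (at r)"
      by (rule approx.G.has_vector_derivative[OF de])
    have error_equation: "Gm (e' r) = \<rho> r - e r"
      using r f by (simp add: e'_def \<rho>_def e_def approx.G.diff approx.T_G exact.T_G)
    let ?d = "(e r \<bullet> e r + r * (e r \<bullet> e' r + e' r \<bullet> e r))
        - (2 * (\<rho> r \<bullet> e r) + 2 * r * (\<rho> r \<bullet> e' r + \<rho>' r \<bullet> e r))
        + 2 * (Gm (e r) \<bullet> e' r + Gm (e' r) \<bullet> e r)"
    show "(\<Psi> has_real_derivative ?d) (at r)"
      unfolding \<Psi>_def
      by (rule derivative_eq_intros inner_deriv[OF de de] inner_deriv[OF d\<rho> de]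
          inner_deriv[OF dGe de] refl)+ (simp add: algebra_simps)
    have "Gm (e r) \<bullet> e' r = Gm (e' r) \<bullet> e r"
      by (metis approx.G_sym inner_commute)
    then have "?d = 2 * (\<rho> r \<bullet> e r) - 3 * (e r \<bullet> e r) - 2 * r * (\<rho>' r \<bullet> e r)
        - 2 * r * (Gm (e' r) \<bullet> e' r)"
      by (simp add: error_equation inner_diff_left inner_commute algebra_simps)
    also have "\<dots> \<le> 2 * (M * norm (e r)) - 3 * (norm (e r))\<^sup>2 + 2 * (M * norm (e r)) - 0"
    proof -
      have "\<rho> r \<bullet> e r \<le> norm (\<rho> r) * norm (e r)" by (rule norm_cauchy_schwarz)
      also have "\<dots> \<le> M * norm (e r)"
        using M1[of r] r by (intro mult_right_mono) (auto simp: \<rho>_def norm_minus_commute)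
      finally have 1: "\<rho> r \<bullet> e r \<le> M * norm (e r)" .
      have "- (\<rho>' r \<bullet> e r) \<le> norm (\<rho>' r) * norm (e r)"
        using norm_cauchy_schwarz[of "- \<rho>' r" "e r"] by simp
      then have "r * - (\<rho>' r \<bullet> e r) \<le> r * (norm (\<rho>' r) * norm (e r))"
        using r by (intro mult_left_mono) auto
      also have "\<dots> = (r * norm (\<rho>' r)) * norm (e r)" by simp
      also have "\<dots> \<le> M * norm (e r)"
        using M2[of r] r by (intro mult_right_mono) (auto simp: \<rho>'_def)
      finally have 2: "- (r * (\<rho>' r \<bullet> e r)) \<le> M * norm (e r)" by simp
      have "0 \<le> \<delta>m * (norm (Gm (e' r)))\<^sup>2" using approx.\<delta> by simp
      also have "\<dots> \<le> Gm (e' r) \<bullet> e' r" using approx.G_dissipative[of "e' r"] by (simp add: inner_commute)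
      finally have "0 \<le> r * (Gm (e' r) \<bullet> e' r)" using r by simp
      with 1 2 show ?thesis by (simp add: power2_norm_eq_inner)
    qed
    also have "\<dots> \<le> 4 * M\<^sup>2"
    proof -
      have "0 \<le> (norm (e r) - 2 * M)\<^sup>2 + 2 * (norm (e r))\<^sup>2" by simp
      then show ?thesis by (simp add: power2_eq_square algebra_simps)
    qed
    finally show "?d \<le> 4 * M\<^sup>2" .
  qed (use t in simp)
  moreover have "\<Psi> 0 = 2 * ((Gm f - p) \<bullet> Gm (Gm f - p))"
  proof -
    have "Gm (e 0) = Gm (Gm f - p)"
      using p by (simp add: e_def approx.T_0 exact.T_0 Gmf approx.G.diff)
    then show ?thesis
      by (simp add: \<Psi>_def) (metis approx.G_sym inner_commute)
  qed
  moreover have "\<Psi> t \<ge> t * ((norm (e t))\<^sup>2 - 2 * M * norm (e t))"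
  proof -
    have "\<rho> t \<bullet> e t \<le> norm (\<rho> t) * norm (e t)" by (rule norm_cauchy_schwarz)
    also have "\<dots> \<le> M * norm (e t)"
      using M1[of t] t by (intro mult_right_mono) (auto simp: \<rho>_def norm_minus_commute)
    finally have "t * (\<rho> t \<bullet> e t) \<le> t * (M * norm (e t))" using t by simp
    moreover have "0 \<le> \<delta>m * (norm (Gm (e t)))\<^sup>2" using approx.\<delta> by simp
    then have "0 \<le> Gm (e t) \<bullet> e t" using approx.G_dissipative[of "e t"] by (simp add: inner_commute)
    ultimately show ?thesis by (simp add: \<Psi>_def power2_norm_eq_inner algebra_simps)
  qed
  moreover have expand: "t * (4 * M\<^sup>2 + 2 * q / t) = 4 * M\<^sup>2 * (t - 0) + 2 * q" for q
    using t by (simp add: distrib_left)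
  ultimately have "t * ((norm (e t))\<^sup>2 - 2 * M * norm (e t))
      \<le> t * (4 * M\<^sup>2 + 2 * ((Gm f - p) \<bullet> Gm (Gm f - p)) / t)"
    unfolding expand by linarith
  then have "(norm (e t))\<^sup>2 - 2 * M * norm (e t) \<le> 4 * M\<^sup>2 + 2 * ((Gm f - p) \<bullet> Gm (Gm f - p)) / t"
    using t by (simp only: mult_le_cancel_left_pos)
  then show ?thesis
    unfolding e_def[symmetric] by (simp add: power2_eq_square algebra_simps)
qed

text \<open>
  The projected initial value \<open>p\<close> need not lie in the domain of the approximate generator, but it is
  a limit of elements \<open>G\<^sub>m f\<close>, for which the term from the initial value in
  \<open>error_energy_estimate\<close> tends to 0. Finally \<open>1 + \<surd>5 \<le> 4\<close>.
\<close>

lemma error_bound_smooth: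
  assumes p: "p \<in> X" "Gm p = Gm (G (G v))" and t: "t > 0"
    and M1: "\<And>r. r \<ge> 0 \<Longrightarrow> norm (G (T r (G v)) - Gm (T r (G v))) \<le> M"
    and M2: "\<And>r. r \<ge> 0 \<Longrightarrow> r * norm (G (T r v) - Gm (T r v)) \<le> M"
  shows "norm (Tm t p - T t (G (G v))) \<le> 4 * M"
proof -
  have "p \<in> closure (Gm ` X)" using p approx.G_dense by simp
  then obtain x where x: "\<And>n. x n \<in> Gm ` X" "x \<longlonglongrightarrow> p"
    using closure_sequential[of p "Gm ` X"] by blast
  have xX: "x n \<in> X" for n using x(1)[of n] approx.G_in by auto
  have bound: "(norm (Tm t (x n) - T t (G (G v))) - M)\<^sup>2
      \<le> 5 * M\<^sup>2 + 2 * ((x n - p) \<bullet> Gm (x n - p)) / t" for n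
    using x(1)[of n] error_energy_estimate[OF _ p t M1 M2] by auto
  have "(\<lambda>n. (norm (Tm t (x n) - T t (G (G v))) - M)\<^sup>2)
      \<longlonglongrightarrow> (norm (Tm t p - T t (G (G v))) - M)\<^sup>2"
    using t by (intro tendsto_intros approx.T_tendsto xX p x) simp
  moreover have "(\<lambda>n. 5 * M\<^sup>2 + 2 * ((x n - p) \<bullet> Gm (x n - p)) / t)
      \<longlonglongrightarrow> 5 * M\<^sup>2 + 2 * ((p - p) \<bullet> Gm (p - p)) / t"
    using t by (intro tendsto_intros approx.G.tendsto x) simp
  ultimately have "(norm (Tm t p - T t (G (G v))) - M)\<^sup>2 \<le> 5 * M\<^sup>2 + 2 * ((p - p) \<bullet> Gm (p - p)) / t"
    by (rule LIMSEQ_le) (use bound in auto)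
  then have le: "(norm (Tm t p - T t (G (G v))) - M)\<^sup>2 \<le> 5 * M\<^sup>2" by simp
  have "M \<ge> 0" using M1[of 0] norm_ge_zero order_trans by blast
  then have "5 * M\<^sup>2 \<le> (3 * M)\<^sup>2" by (simp add: power_mult_distrib)
  from order_trans[OF le this] have "norm (Tm t p - T t (G (G v))) - M \<le> 3 * M"
    by (rule power2_le_imp_le) (use \<open>M \<ge> 0\<close> in simp)
  then show ?thesis by simp
qed

end

locale fractional_semigroup_pair =
  exact: stable_semigroup G \<delta> T + approx: inverse_semigroup X Gm \<delta>m Tm
  for G :: "'h::{complex_hilbert, second_countable_topology} \<Rightarrow> 'h" and \<delta> T
    and X :: "'h set" and Gm :: "'h \<Rightarrow> 'h" and \<delta>m Tm
begin

sublocale semigroup_pair ..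

text \<open>
  For \<open>y\<close> in the domain of \<open>A\<^sup>2\<close>, put \<open>z = A\<^sup>-\<^sup>s y\<close>. The initial value is \<open>A\<^sup>-\<^sup>1 z\<close>, and the error of
  the stationary problem along the orbit is that for the right-hand side \<open>T(t) z = A\<^sup>-\<^sup>s T(t) y\<close>, hence at most
  \<open>C |y|\<close>. Its time derivative is the error for \<open>A\<^sup>-\<^sup>s A T(t) y\<close>, to which the smoothing estimate
  for \<open>t |A T(t) y|\<close> applies. So \<open>error_bound_smooth\<close> holds with \<open>M = C |y|\<close>. The domain of \<open>A\<^sup>2\<close> is dense, and both sides depend
  continuously on \<open>y\<close>; time 0 is reached as a limit.
\<close>

lemma error_bound_fractional:
  assumes s: "s > 0" and C: "C \<ge> 0"
    and D: "\<And>y. norm (G (exact.neg_power s y) - Gm (exact.neg_power s y)) \<le> C * norm y"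
    and P: "bounded_linear P" and P_in: "\<And>x. P x \<in> X" and Gm_P: "\<And>x. Gm (P x) = Gm x"
    and t: "t \<ge> 0"
  shows "norm (Tm t (P (exact.neg_power (s + 1) y)) - T t (exact.neg_power (s + 1) y))
           \<le> 4 * (C * norm y)"
    (is "?Q t y")
proof -
  have s1: "s + 1 > 0" using s by simp
  have smooth: "?Q t (G (G y))" if t: "t > 0" for t y
  proof -
    let ?v = "exact.neg_power s (G y)"
    have Gv: "G ?v = exact.neg_power s (G (G y))" by (rule exact.neg_power_G[OF s])
    have GGv: "G (G ?v) = exact.neg_power (s + 1) (G (G y))"
      unfolding Gv by (rule exact.G_neg_power[OF s])
    have "norm (Tm t (P (G (G ?v))) - T t (G (G ?v))) \<le> 4 * (C * norm (G (G y)))"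
    proof (rule error_bound_smooth[OF P_in Gm_P t])
      fix r :: real assume r: "r \<ge> 0"
      have "norm (G (T r (G ?v)) - Gm (T r (G ?v))) \<le> C * norm (T r (G (G y)))"
        unfolding Gv exact.neg_power_T[OF s r] by (rule D)
      also have "\<dots> \<le> C * norm (G (G y))"
        using C r by (intro mult_left_mono exact.T_contractive) auto
      finally show "norm (G (T r (G ?v)) - Gm (T r (G ?v))) \<le> C * norm (G (G y))" .
      have "r * norm (G (T r ?v) - Gm (T r ?v)) \<le> r * (C * norm (T r (G y)))"
        unfolding exact.neg_power_T[OF s r] by (intro mult_left_mono D r)
      also have "\<dots> = C * (r * norm (T r (G y)))" by simp
      also have "\<dots> \<le> C * norm (G (G y))"
        using C r by (intro mult_left_mono exact.analyticity_bound) auto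
      finally show "r * norm (G (T r ?v) - Gm (T r ?v)) \<le> C * norm (G (G y))" .
    qed
    then show ?thesis unfolding GGv .
  qed
  have Q_limit: "?Q t y" if t: "t \<ge> 0" and z: "\<And>n. ?Q t (z n)" "z \<longlonglongrightarrow> y" for t z y
  proof -
    have np: "(\<lambda>n. exact.neg_power (s + 1) (z n)) \<longlonglongrightarrow> exact.neg_power (s + 1) y"
      by (rule exact.neg_power_tendsto[OF s1 z(2)])
    have "(\<lambda>n. norm (Tm t (P (exact.neg_power (s + 1) (z n))) - T t (exact.neg_power (s + 1) (z n))))
        \<longlonglongrightarrow> norm (Tm t (P (exact.neg_power (s + 1) y)) - T t (exact.neg_power (s + 1) y))"
      by (intro tendsto_norm tendsto_diff approx.T_tendsto exact.T_tendsto t P_in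
          bounded_linear.tendsto[OF P] np) auto
    moreover have "(\<lambda>n. 4 * (C * norm (z n))) \<longlonglongrightarrow> 4 * (C * norm y)"
      by (intro tendsto_intros z)
    ultimately show ?thesis by (rule LIMSEQ_le) (use z(1) in auto)
  qed
  have once: "?Q t (G y)" if t: "t > 0" for t y
  proof -
    have "y \<in> UNIV" by simp
    then show ?thesis
    proof (induction rule: exact.G_density_induct)
      case (limit z x)
      show ?case
        by (rule Q_limit[of t "\<lambda>n. G (z n)"])
          (use t limit in \<open>auto intro: exact.G.tendsto\<close>)
    qed (rule smooth[OF t])
  qed
  have pos: "?Q t y" if t: "t > 0" for t y
  proof -
    have "y \<in> UNIV" by simp
    then show ?thesis
    proof (induction rule: exact.G_density_induct)
      case (limit z x)
      show ?case
        by (rule Q_limit[of t z])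
          (use t limit in auto)
    qed (rule once[OF t])
  qed
  show ?thesis
  proof (cases "t = 0")
    case True
    let ?u = "exact.neg_power (s + 1) y"
    have "((\<lambda>t. norm (Tm t (P ?u) - T t ?u)) \<longlongrightarrow> norm (P ?u - ?u)) (at_right 0)"
      by (intro tendsto_norm tendsto_diff approx.T_right exact.T_right P_in) auto
    moreover have "\<forall>\<^sub>F t in at_right 0. norm (Tm t (P ?u) - T t ?u) \<le> 4 * (C * norm y)"
      by (rule eventually_mono[OF eventually_at_right_less pos])
    ultimately have "norm (P ?u - ?u) \<le> 4 * (C * norm y)"
      by (intro tendsto_upperbound) auto
    then show ?thesis using True by (simp add: approx.T_0 exact.T_0 P_in)
  qed (use t pos in auto)
qed

end

section \<open>Complex structure\<close>

lemma csubspace_imp_subspace: "csubspace S \<Longrightarrow> subspace S"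
  by (auto simp: csubspace_def subspace_def scaleR_scaleC)

lemma cinner_scaleC_right: "cinner x (c *\<^sub>C y) = cnj c * cinner x y"
  by (metis cinner_commute cinner_scaleC_left complex_cnj_cnj complex_cnj_mult)

lemma Im_cinner: "Im (cinner x y) = x \<bullet> (\<i> *\<^sub>C y)"
  by (simp add: inner_eq_Re_cinner cinner_scaleC_right)

lemma norm_scaleC: "norm (c *\<^sub>C x) = cmod c * norm x"
proof -
  have "cinner (c *\<^sub>C x) (c *\<^sub>C x) = of_real ((cmod c)\<^sup>2) * cinner x x"
    by (simp add: cinner_scaleC_left cinner_scaleC_right complex_norm_square mult_ac del: of_real_power)
  then have "(norm (c *\<^sub>C x))\<^sup>2 = (cmod c * norm x)\<^sup>2"
    by (simp add: power2_norm_eq_inner inner_eq_Re_cinner power_mult_distrib del: of_real_power)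
  then show ?thesis by simp
qed

lemma bounded_linear_scaleC: "bounded_linear ((*\<^sub>C) c)"
  by (rule bounded_linear_intro[of _ "cmod c"])
    (simp_all add: scaleC_add_right scaleR_scaleC scaleC_scaleC norm_scaleC mult.commute)

lemma csubspace_closure:
  assumes "csubspace S"
  shows "csubspace (closure S)"
proof -
  have "subspace (closure S)" by (intro subspace_closure csubspace_imp_subspace assms)
  moreover have "c *\<^sub>C x \<in> closure S" if x: "x \<in> closure S" for c x
  proof -
    obtain f where f: "\<And>n. f n \<in> S" "f \<longlonglongrightarrow> x"
      using iffD1[OF closure_sequential x] by blast
    have "\<forall>n. c *\<^sub>C f n \<in> S" using f(1) assms by (simp add: csubspace_def)
    moreover have "(\<lambda>n. c *\<^sub>C f n) \<longlonglongrightarrow> c *\<^sub>C x"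
      by (rule bounded_linear.tendsto[OF bounded_linear_scaleC f(2)])
    ultimately show ?thesis unfolding closure_sequential by (intro exI conjI)
  qed
  ultimately show ?thesis by (auto simp: csubspace_def subspace_def)
qed

text \<open>
  Orthogonality for the real inner product is orthogonality for the complex one, as the subspace is
  invariant under multiplication by \<open>\<i>\<close>.
\<close>

lemma orth_proj_characterization:
  fixes S :: "'h::complex_hilbert set"
  assumes S: "csubspace S" "closed S"
  shows "orth_proj S x \<in> S" and "z \<in> S \<Longrightarrow> (x - orth_proj S x) \<bullet> z = 0"
proof -
  have S': "subspace S" by (rule csubspace_imp_subspace[OF S(1)])
  obtain y where y: "y \<in> S" "\<And>z. z \<in> S \<Longrightarrow> (x - y) \<bullet> z = 0"
    using orthogonal_projection_exists[OF S' S(2)] by blast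
  have zero: "cinner (x - y) z = 0" if "z \<in> S" for z
  proof (rule complex_eqI)
    show "Re (cinner (x - y) z) = Re 0" using y(2)[OF that] by (simp add: inner_eq_Re_cinner)
    have "\<i> *\<^sub>C z \<in> S" using that S(1) by (simp add: csubspace_def)
    then show "Im (cinner (x - y) z) = Im 0" using y(2) by (simp add: Im_cinner)
  qed
  have unique: "y' = y" if y': "y' \<in> S" "\<forall>z\<in>S. cinner (x - y') z = 0" for y'
  proof -
    have yy: "y' - y \<in> S" using y y' S' by (simp add: subspace_diff)
    then have "(x - y') \<bullet> (y' - y) = 0" using y' by (simp add: inner_eq_Re_cinner)
    with y(2)[OF yy] have "(y' - y) \<bullet> (y' - y) = 0" by (simp add: inner_diff_left)
    then show ?thesis by simp
  qed
  have "orth_proj S x = y"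
    unfolding orth_proj_def
  proof (rule the_equality)
    show "y \<in> S \<and> (\<forall>z\<in>S. cinner (x - y) z = 0)" using y(1) zero by blast
  qed (use unique in blast)
  then show "orth_proj S x \<in> S" and "z \<in> S \<Longrightarrow> (x - orth_proj S x) \<bullet> z = 0"
    using y by auto
qed

lemma bounded_linear_orth_proj:
  fixes S :: "'h::complex_hilbert set"
  assumes S: "csubspace S" "closed S"
  shows "bounded_linear (orth_proj S)"
proof -
  note P_in = orth_proj_characterization(1)[OF S] and P_orth = orth_proj_characterization(2)[OF S]
  have S': "subspace S" by (rule csubspace_imp_subspace[OF S(1)])
  have unique: "y = orth_proj S x" if y: "y \<in> S" "\<And>z. z \<in> S \<Longrightarrow> (x - y) \<bullet> z = 0" for x y
  proof -
    have yy: "y - orth_proj S x \<in> S" using y P_in S' by (simp add: subspace_diff)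
    have "(y - orth_proj S x) \<bullet> (y - orth_proj S x) = 0"
      using y(2)[OF yy] P_orth[OF yy, of x] by (simp add: inner_diff_left)
    then show ?thesis by simp
  qed
  show ?thesis
  proof (rule bounded_linear_intro[of _ 1])
    show "orth_proj S (x + y) = orth_proj S x + orth_proj S y" for x y
    proof (rule unique[symmetric])
      show "orth_proj S x + orth_proj S y \<in> S" by (intro subspace_add S' P_in)
      show "(x + y - (orth_proj S x + orth_proj S y)) \<bullet> z = 0" if "z \<in> S" for z
        using P_orth[OF that, of x] P_orth[OF that, of y] by (simp add: inner_diff_left inner_add_left)
    qed
    show "orth_proj S (c *\<^sub>R x) = c *\<^sub>R orth_proj S x" for c x
    proof (rule unique[symmetric])
      show "c *\<^sub>R orth_proj S x \<in> S" by (intro subspace_scale S' P_in)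
      show "(c *\<^sub>R x - c *\<^sub>R orth_proj S x) \<bullet> z = 0" if "z \<in> S" for z
        using P_orth[OF that, of x] by (simp flip: scaleR_diff_right)
    qed
    show "norm (orth_proj S x) \<le> norm x * 1" for x
    proof -
      have "(norm (orth_proj S x))\<^sup>2 = x \<bullet> orth_proj S x"
        using P_orth[OF P_in, of x x] by (simp add: power2_norm_eq_inner inner_diff_left)
      also have "\<dots> \<le> norm x * norm (orth_proj S x)" by (rule norm_cauchy_schwarz)
      finally show ?thesis
        by (cases "orth_proj S x = 0") (simp_all add: power2_eq_square)
    qed
  qed
qed

section \<open>Complex forms\<close>

lemma infdist_le_of_decay:
  assumes "decays_with_rate (\<lambda>m. galerkin_gamma a (V m) \<iota> X nrm) p"
  shows "\<exists>C\<ge>0. \<forall>m\<ge>1. \<forall>f\<in>X. nrm f = 1 \<longrightarrow>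
    infdist (form_inverse a (\<iota> f)) (V m) \<le> C * real m powr (- p)"
proof -
  obtain C where C: "C \<ge> 0"
    and le: "\<And>m. m \<ge> 1 \<Longrightarrow> galerkin_gamma a (V m) \<iota> X nrm \<le> ennreal (C * real m powr (- p))"
    using assms unfolding decays_with_rate_def by blast
  have "infdist (form_inverse a (\<iota> f)) (V m) \<le> C * real m powr (- p)"
    if m: "m \<ge> 1" and f: "f \<in> X" "nrm f = 1" for m f
  proof -
    have "ennreal (infdist (form_inverse a (\<iota> f)) (V m)) \<le> galerkin_gamma a (V m) \<iota> X nrm"
      unfolding galerkin_gamma_def using f by (intro SUP_upper) auto
    also have "\<dots> \<le> ennreal (C * real m powr (- p))" by (rule le[OF m])
    finally show ?thesis using C by (simp add: ennreal_le_iff)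
  qed
  with C show ?thesis by blast
qed

text \<open>
  Only the real part of the form enters the real theory, but its symmetry, bound and coercivity are those
  of the complex form.
\<close>

locale complex_form =
  fixes j :: "'v::complex_hilbert \<Rightarrow> 'h::complex_hilbert"
    and a :: "'v \<Rightarrow> 'v \<Rightarrow> complex" and k K :: real
  assumes dense: "dense_embedding j" and sesq: "sesquilinear a" and sym: "symmetric_form a"
    and k_pos: "k > 0" and a_coercive: "\<And>u. k * (norm u)\<^sup>2 \<le> Re (a u u)"
    and a_bounded: "\<And>u v. cmod (a u v) \<le> K * norm u * norm v"
begin

lemma a_linear:
  "a (u + u') v = a u v + a u' v" "a (c *\<^sub>C u) v = c * a u v"
  "a u (v + v') = a u v + a u v'" "a u (c *\<^sub>C v) = cnj c * a u v"
  using sesq by (auto simp: sesquilinear_def)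

lemma j_linear: "j (u + v) = j u + j v" "j (c *\<^sub>C u) = c *\<^sub>C j u"
  using dense by (auto simp: dense_embedding_def bounded_clinear_on_def)

sublocale galerkin_form j "\<lambda>u v. Re (a u v)" k K
proof (rule galerkin_form.intro)
  obtain N where N: "\<And>u. norm (j u) \<le> N * norm u"
    using dense by (auto simp: dense_embedding_def bounded_clinear_on_def)
  show "bounded_linear j"
    by (rule bounded_linear_intro[of _ N]) (simp_all add: j_linear scaleR_scaleC N mult.commute)
  show le: "Re (a u v) \<le> K * norm u * norm v" for u v
    by (rule order_trans[OF complex_Re_le_cmod a_bounded])
  show "bounded_bilinear (\<lambda>u v. Re (a u v))"
  proof (rule bounded_bilinear.intro)
    show "\<exists>K. \<forall>u v. norm (Re (a u v)) \<le> norm u * norm v * K"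
    proof (intro exI[of _ K] allI)
      show "norm (Re (a u v)) \<le> norm u * norm v * K" for u v
        using order_trans[OF abs_Re_le_cmod a_bounded[of u v]] by (simp add: mult_ac)
    qed
  qed (simp_all add: a_linear scaleR_scaleC)
  show "Re (a u v) = Re (a v u)" for u v
    using arg_cong[of _ _ Re, OF sym[unfolded symmetric_form_def, rule_format, of u v]] by simp
qed (rule k_pos a_coercive)+

lemma adjoint_form_eq: "adjoint_form a = a"
proof (intro ext)
  show "adjoint_form a u v = a u v" for u v
    unfolding adjoint_form_def by (rule sym[unfolded symmetric_form_def, rule_format, symmetric])
qed

context
  fixes W :: "'v set" assumes W: "csubspace W" "closed W"
begin

lemma real_subspace: "subspace W" using W(1) by (rule csubspace_imp_subspace)

text \<open>
  The real parts of the equations, tested with \<open>v\<close> and with \<open>\<i> v\<close>, are the complex equations.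
\<close>

lemma form_eq_iff_sol:
  assumes "u \<in> W"
  shows "(\<forall>v\<in>W. a u v = cinner f (j v)) \<longleftrightarrow> u = sol W f"
proof
  assume "\<forall>v\<in>W. a u v = cinner f (j v)"
  then show "u = sol W f"
    using assms by (intro sol_unique[OF real_subspace W(2)]) (simp_all add: inner_eq_Re_cinner)
next
  assume u: "u = sol W f"
  have Re_eq: "Re (a u v) = f \<bullet> j v" if "v \<in> W" for v
    unfolding u by (rule sol_eq[OF real_subspace W(2) that])
  show "\<forall>v\<in>W. a u v = cinner f (j v)"
  proof (intro ballI complex_eqI)
    fix v assume v: "v \<in> W"
    show "Re (a u v) = Re (cinner f (j v))" using Re_eq[OF v] by (simp add: inner_eq_Re_cinner)
    have "\<i> *\<^sub>C v \<in> W" using v W(1) by (simp add: csubspace_def)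
    from Re_eq[OF this] show "Im (a u v) = Im (cinner f (j v))"
      by (simp add: a_linear j_linear Im_cinner)
  qed
qed

lemma form_operator_eq: "form_operator j a W = {(sol_op W f, f) | f. f \<in> closure (j ` W)}"
proof -
  have "form_operator j a W = {(j u, f) | u f. u \<in> W \<and> f \<in> closure (j ` W) \<and> u = sol W f}"
    unfolding form_operator_def using form_eq_iff_sol by blast
  also have "\<dots> = {(sol_op W f, f) | f. f \<in> closure (j ` W)}"
    unfolding sol_op_def using sol_in[OF real_subspace W(2)] by blast
  finally show ?thesis .
qed

lemma csubspace_image: "csubspace (j ` W)"
proof -
  have "c *\<^sub>C j u \<in> j ` W" if "u \<in> W" for c u
    using that W(1) j_linear(2)[symmetric] by (auto simp: csubspace_def)
  then show ?thesis
    using subspace_image[OF real_subspace W(2)] by (auto simp: csubspace_def subspace_def)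
qed

lemma sol_op_orth_proj: "sol_op W (orth_proj (closure (j ` W)) f) = sol_op W f"
proof -
  note P = orth_proj_characterization(2)[OF csubspace_closure[OF csubspace_image] closed_closure]
  show ?thesis by (rule sol_op_cong_orthogonal[OF real_subspace W(2), symmetric]) (rule P)
qed

text \<open>
  The given generator is the abstract one: \<open>form_operator j a W\<close> consists of the pairs of \<open>sol_op W f\<close>
  and \<open>f\<close>, so the semigroup results apply both to the exact evolution (\<open>W = UNIV\<close>) and to
  its Galerkin approximations.
\<close>

lemma inverse_semigroup_form_operator:
  assumes N: "N > 0" "\<And>v. norm (j v) \<le> norm v * N"
    and S: "generated_by_neg (closure (j ` W)) S (form_operator j a W)"
  shows "inverse_semigroup (closure (j ` W)) (sol_op W) (k / N\<^sup>2) S"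
proof (rule inverse_semigroup.intro)
  note form = real_subspace W(2)
  show "subspace (closure (j ` W))" by (rule subspace_closure[OF subspace_image[OF form]])
  show "bounded_linear (sol_op W)" by (rule bounded_linear_sol_op[OF form])
  show "sol_op W f \<in> closure (j ` W)" for f by (rule sol_op_in[OF form])
  show "sol_op W f \<bullet> g = f \<bullet> sol_op W g" for f g by (rule sol_op_symmetric[OF form])
  show "k / N\<^sup>2 * (norm (sol_op W f))\<^sup>2 \<le> f \<bullet> sol_op W f" for f
    by (rule sol_op_dissipative[OF form N])
  show "closure (sol_op W ` closure (j ` W)) = closure (j ` W)"
    by (rule range_sol_op_dense[OF form])
  show "generated_by_neg (closure (j ` W)) S {(sol_op W f, f) | f. f \<in> closure (j ` W)}"
    using S unfolding form_operator_eq .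
qed (use k_pos N in simp_all)

end

lemma csubspace_UNIV: "csubspace (UNIV :: 'v set)" "closed (UNIV :: 'v set)"
  by (auto simp: csubspace_def)

lemma closure_range_j: "closure (range j) = UNIV"
  using dense by (simp add: dense_embedding_def)

lemma form_inverse_eq: "form_inverse a (to_antidual j f) = sol UNIV f"
proof -
  have "a u = to_antidual j f \<longleftrightarrow> u = sol UNIV f" for u
    using form_eq_iff_sol[OF csubspace_UNIV, of u f] by (auto simp: fun_eq_iff to_antidual_def)
  then show ?thesis by (simp add: form_inverse_def)
qed

text \<open>
  Decay of the suprema is an assumption on right-hand sides of norm 1. Homogeneity of the error
  of the Galerkin solution, which by Cea's lemma is comparable to the distance, extends it to
  right-hand sides of norm \<open>r\<close>.
\<close>

lemma norm_err_le_of_scaled: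
  assumes W: "csubspace W" "closed W" and K: "K \<ge> 0" and r: "r > 0"
    and d: "infdist (form_inverse a (to_antidual j ((1 / r) *\<^sub>R f))) W \<le> d"
  shows "norm (err W f) \<le> K / k * d * r"
proof -
  note W' = real_subspace[OF W] W(2)
  have "err W ((1 / r) *\<^sub>R f) = (1 / r) *\<^sub>R err W f"
    by (simp add: err_def sol_scaleR[OF UNIV_subspace] sol_scaleR[OF W'] scaleR_diff_right)
  then have "norm (err W f) = r * norm (err W ((1 / r) *\<^sub>R f))" using r by simp
  also have "\<dots> \<le> r * (K / k * infdist (sol UNIV ((1 / r) *\<^sub>R f)) W)"
    using r by (intro mult_left_mono cea[OF W' K]) auto
  also have "\<dots> \<le> r * (K / k * d)"
    using r K k_pos d by (intro mult_left_mono) (auto simp: form_inverse_eq)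
  finally show ?thesis by (simp add: mult_ac)
qed

lemma err_zero: "csubspace W \<Longrightarrow> closed W \<Longrightarrow> err W 0 = 0"
  using sol_scaleR[OF UNIV_subspace, of 0 0] sol_scaleR[OF real_subspace, of W 0 0]
  by (simp add: err_def)

end

section \<open>Convergence of the Galerkin semigroups\<close>

text \<open>
  The error of the stationary problem on \<open>dom(A\<^sup>s)\<close> has rate \<open>p1 + p2\<close>: Cea's lemma provides \<open>p1\<close> and
  the dual problem \<open>p2\<close>. The norms \<open>|y|\<close> and \<open>sqrt (|y|\<^sup>2 + |A\<^sup>-\<^sup>s y|\<^sup>2)\<close> of \<open>A\<^sup>-\<^sup>s y\<close> are
  equivalent as \<open>A\<^sup>-\<^sup>s\<close> is bounded. The resulting constant does not depend on the length of the time interval.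
\<close>

lemma galerkin_error_estimate:
  fixes j :: "'v::{complex_hilbert, second_countable_topology}
      \<Rightarrow> 'h::{complex_hilbert, second_countable_topology}"
    and a :: "'v \<Rightarrow> 'v \<Rightarrow> complex"
  assumes "dense_embedding j"
    and "sesquilinear a" and "bounded_form a" and "coercive_form a" and "symmetric_form a"
    and A: "A = form_operator j a UNIV"
    and T: "generated_by_neg UNIV T A"
    and V: "approximating_sequence V"
    and Hm: "\<And>m. Hm m = closure (j ` V m)"
    and Tm: "\<And>m. m \<ge> 1 \<Longrightarrow> generated_by_neg (Hm m) (Tm m) (form_operator j a (V m))"
    and s: "s > 0"
    and rate1: "decays_with_rate
           (\<lambda>m. galerkin_gamma a (V m) (to_antidual j)
                  (Domain (frac_power A s)) (graph_norm (frac_power A s))) p1"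
    and rate2: "decays_with_rate
           (\<lambda>m. galerkin_gamma (adjoint_form a) (V m) (to_antidual j) UNIV norm) p2"
  shows "\<exists>C\<ge>0. \<forall>t\<ge>0. \<forall>u0\<in>Domain (frac_power A (s + 1)). \<forall>m\<ge>1.
            norm (Tm m t (orth_proj (Hm m) u0) - T t u0)
              \<le> C * real m powr (- (p1 + p2)) * graph_norm (frac_power A (s + 1)) u0"
proof -
  obtain K0 where K0: "\<And>u v. cmod (a u v) \<le> K0 * norm u * norm v"
    using \<open>bounded_form a\<close> by (auto simp: bounded_form_def)
  define K where "K = \<bar>K0\<bar>"
  have K_nonneg: "K \<ge> 0" by (simp add: K_def)
  obtain k where k: "k > 0" "\<And>u. k * (norm u)\<^sup>2 \<le> Re (a u u)"
    using \<open>coercive_form a\<close> by (auto simp: coercive_form_def)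
  have "cmod (a u v) \<le> K * norm u * norm v" for u v
    using K0[of u v] unfolding K_def
    by (elim order_trans) (intro mult_right_mono abs_ge_self; simp)
  then interpret complex_form j a k K
    using assms k by unfold_locales auto
  obtain N where N: "N > 0" "\<And>v. norm (j v) \<le> norm v * N" using j.pos_bounded by blast
  let ?G = "sol_op UNIV" and ?\<delta> = "k / N\<^sup>2"
  have A_eq: "A = {(?G f, f) | f. f \<in> UNIV}"
    unfolding A form_operator_eq[OF csubspace_UNIV] closure_range_j ..
  interpret E: stable_semigroup ?G ?\<delta> T
    unfolding stable_semigroup_def
    using inverse_semigroup_form_operator[OF csubspace_UNIV N, of T] T
    unfolding A closure_range_j .
  have s1: "s + 1 > 0" using s by simp
  have pow: "Domain (frac_power A r) = range (E.neg_power r)" if "r > 0" for r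
    unfolding A_eq E.frac_power_eq[OF that] by auto
  have graph: "graph_norm (frac_power A r) (E.neg_power r y)
      = sqrt ((norm y)\<^sup>2 + (norm (E.neg_power r y))\<^sup>2)" if "r > 0" for r y
    unfolding A_eq graph_norm_def E.op_apply_frac_power[OF that] ..
  obtain C1 where C1: "C1 \<ge> 0"
    and dist1: "\<And>m f. m \<ge> 1 \<Longrightarrow> f \<in> Domain (frac_power A s) \<Longrightarrow> graph_norm (frac_power A s) f = 1
      \<Longrightarrow> infdist (form_inverse a (to_antidual j f)) (V m) \<le> C1 * real m powr (- p1)"
    using infdist_le_of_decay[OF rate1] by blast
  obtain C2 where C2: "C2 \<ge> 0"
    and dist2: "\<And>m f. m \<ge> 1 \<Longrightarrow> norm f = 1
      \<Longrightarrow> infdist (form_inverse a (to_antidual j f)) (V m) \<le> C2 * real m powr (- p2)"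
    using infdist_le_of_decay[OF rate2[unfolded adjoint_form_eq]] by blast
  define B where "B = E.neg_power_bound s"
  define c1 where "c1 m = K / k * (C1 * real m powr (- p1)) * sqrt (1 + B\<^sup>2)" for m
  define c2 where "c2 m = K / k * (C2 * real m powr (- p2))" for m
  have Vm: "csubspace (V m)" "closed (V m)" if "m \<ge> 1" for m
    using V that by (auto simp: approximating_sequence_def)
  have err1: "norm (err (V m) (E.neg_power s y)) \<le> c1 m * norm y" if m: "m \<ge> 1" for m y
  proof (cases "y = 0")
    case True
    have "E.neg_power s 0 = 0" using E.neg_power_scaleR[OF s, of 0 0] by simp
    then show ?thesis using True err_zero[OF Vm[OF m]] by simp
  next
    case False
    define r where "r = sqrt ((norm y)\<^sup>2 + (norm (E.neg_power s y))\<^sup>2)"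
    have "(norm y)\<^sup>2 > 0" using False by simp
    then have r: "r > 0" unfolding r_def by (intro real_sqrt_gt_zero add_pos_nonneg) auto
    have sc: "(1 / r) *\<^sub>R E.neg_power s y = E.neg_power s ((1 / r) *\<^sub>R y)"
      by (rule E.neg_power_scaleR[OF s, symmetric])
    have "graph_norm (frac_power A s) ((1 / r) *\<^sub>R E.neg_power s y)
        = sqrt ((norm ((1 / r) *\<^sub>R y))\<^sup>2 + (norm ((1 / r) *\<^sub>R E.neg_power s y))\<^sup>2)"
      using graph[OF s, of "(1 / r) *\<^sub>R y"] by (simp only: sc)
    also have "\<dots> = sqrt ((1 / r)\<^sup>2 * ((norm y)\<^sup>2 + (norm (E.neg_power s y))\<^sup>2))"
      unfolding norm_scaleR power_mult_distrib power2_abs by (simp only: distrib_left)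
    also have "\<dots> = 1 / r * r"
      unfolding real_sqrt_mult r_def[symmetric] using r by simp
    finally have "graph_norm (frac_power A s) ((1 / r) *\<^sub>R E.neg_power s y) = 1" using r by simp
    then have "norm (err (V m) (E.neg_power s y)) \<le> K / k * (C1 * real m powr (- p1)) * r"
      by (intro norm_err_le_of_scaled Vm m K_nonneg r dist1) (auto simp: pow[OF s] sc)
    also have "\<dots> \<le> K / k * (C1 * real m powr (- p1)) * (sqrt (1 + B\<^sup>2) * norm y)"
    proof (rule mult_left_mono)
      have "(norm (E.neg_power s y))\<^sup>2 \<le> (B * norm y)\<^sup>2"
        unfolding B_def by (intro power_mono E.norm_neg_power_le[OF s]) simp
      then have "r \<le> sqrt ((1 + B\<^sup>2) * (norm y)\<^sup>2)"
        unfolding r_def by (intro real_sqrt_le_mono) (simp add: power_mult_distrib algebra_simps)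
      then show "r \<le> sqrt (1 + B\<^sup>2) * norm y" by (simp add: real_sqrt_mult)
      show "0 \<le> K / k * (C1 * real m powr (- p1))" using K_nonneg k_pos C1 by simp
    qed
    finally show ?thesis by (simp add: c1_def mult_ac)
  qed
  have err2: "norm (err (V m) f) \<le> c2 m * norm f" if m: "m \<ge> 1" for m f
  proof (cases "f = 0")
    case False
    then show ?thesis unfolding c2_def
      by (intro norm_err_le_of_scaled Vm m K_nonneg dist2) auto
  qed (simp add: err_zero[OF Vm[OF m]])
  define C where "C = 4 * (K * (K / k * C2) * (K / k * C1 * sqrt (1 + B\<^sup>2)))"
  have C_nonneg: "C \<ge> 0" using K_nonneg k_pos C1 C2 by (simp add: C_def)
  have "norm (Tm m t (orth_proj (Hm m) u0) - T t u0)
      \<le> C * real m powr (- (p1 + p2)) * graph_norm (frac_power A (s + 1)) u0"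
    if t: "t \<ge> 0" and u0: "u0 \<in> Domain (frac_power A (s + 1))" and m: "m \<ge> 1" for t u0 m
  proof -
    note Vr = real_subspace[OF Vm[OF m]] Vm(2)[OF m]
    interpret M: inverse_semigroup "Hm m" "sol_op (V m)" ?\<delta> "Tm m"
      unfolding Hm by (rule inverse_semigroup_form_operator[OF Vm[OF m] N Tm[OF m, unfolded Hm]])
    interpret pair: fractional_semigroup_pair ?G ?\<delta> T "Hm m" "sol_op (V m)" ?\<delta> "Tm m" ..
    have HC: "csubspace (Hm m)" "closed (Hm m)"
      unfolding Hm by (intro csubspace_closure csubspace_image Vm m closed_closure)+
    have CC: "K * c2 m * c1 m \<ge> 0" using K_nonneg k_pos C1 C2 by (simp add: c1_def c2_def)
    obtain y where y: "u0 = E.neg_power (s + 1) y" using u0 unfolding pow[OF s1] by blast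
    have "norm (?G (E.neg_power s z) - sol_op (V m) (E.neg_power s z)) \<le> K * c2 m * c1 m * norm z" for z
    proof -
      have "norm (?G (E.neg_power s z) - sol_op (V m) (E.neg_power s z))
          \<le> K * c2 m * norm (err (V m) (E.neg_power s z))"
        by (rule aubin_nitsche[OF Vr K_nonneg err2[OF m]])
      also have "\<dots> \<le> K * c2 m * (c1 m * norm z)"
        using K_nonneg k_pos C2 by (intro mult_left_mono err1 m) (simp add: c2_def)
      finally show ?thesis by simp
    qed
    then have "norm (Tm m t (orth_proj (Hm m) u0) - T t u0) \<le> 4 * (K * c2 m * c1 m * norm y)"
      unfolding y
      by (rule pair.error_bound_fractional[OF s CC _ bounded_linear_orth_proj[OF HC]
            orth_proj_characterization(1)[OF HC] _ t])
        (simp add: Hm sol_op_orth_proj[OF Vm[OF m]])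
    also have "4 * (K * c2 m * c1 m * norm y) = C * real m powr (- (p1 + p2)) * norm y"
      by (simp add: C_def c1_def c2_def powr_diff powr_minus divide_inverse mult_ac powr_add)
    also have "\<dots> \<le> C * real m powr (- (p1 + p2)) * graph_norm (frac_power A (s + 1)) u0"
    proof (rule mult_left_mono)
      show "norm y \<le> graph_norm (frac_power A (s + 1)) u0"
        unfolding y graph[OF s1] by (intro real_le_rsqrt) simp
    qed (use C_nonneg in simp)
    finally show ?thesis .
  qed
  then show ?thesis using C_nonneg by blast
qed

theorem theorem3p7:
  fixes j :: "'v::{complex_hilbert, second_countable_topology}
      \<Rightarrow> 'h::{complex_hilbert, second_countable_topology}"
    and a :: "'v \<Rightarrow> 'v \<Rightarrow> complex"
    and A :: "('h \<times> 'h) set"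
    and V :: "nat \<Rightarrow> 'v set"
    and Hm :: "nat \<Rightarrow> 'h set"
    and T :: "real \<Rightarrow> 'h \<Rightarrow> 'h"
    and Tm :: "nat \<Rightarrow> real \<Rightarrow> 'h \<Rightarrow> 'h"
    and s p1 p2 :: real
  assumes "dense_embedding j"
    and "sesquilinear a" and "bounded_form a" and "coercive_form a" and "symmetric_form a"
    and A: "A = form_operator j a UNIV"
    and T: "generated_by_neg UNIV T A"
    and "approximating_sequence V"
    and Hm: "\<And>m. Hm m = closure (j ` V m)"
    and Tm: "\<And>m. m \<ge> 1 \<Longrightarrow> generated_by_neg (Hm m) (Tm m) (form_operator j a (V m))"
    and "s > 0" and "p1 \<ge> 0" and "p2 \<ge> 0"
    and "decays_with_rate
           (\<lambda>m. galerkin_gamma a (V m) (to_antidual j)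
                  (Domain (frac_power A s)) (graph_norm (frac_power A s))) p1"
    and "decays_with_rate
           (\<lambda>m. galerkin_gamma (adjoint_form a) (V m) (to_antidual j) UNIV norm) p2"
  shows "(\<forall>Tbar\<ge>0. \<exists>C. \<forall>t\<in>{0..Tbar}. \<forall>u0\<in>Domain (frac_power A (s + 1)). \<forall>m\<ge>1.
            norm (Tm m t (orth_proj (Hm m) u0) - T t u0)
              \<le> C * (graph_norm (frac_power A (s + 1)) u0 / real m powr (p1 + p2))) \<and>
         (p1 + p2 > 0 \<longrightarrow>
            evolution_convergence_of_order T Hm Tm
              (Domain (frac_power A (s + 1))) (graph_norm (frac_power A (s + 1))) (p1 + p2))"
proof -
  obtain C where C: "C \<ge> 0"
    and bound: "\<And>t u0 m. t \<ge> 0 \<Longrightarrow> u0 \<in> Domain (frac_power A (s + 1)) \<Longrightarrow> m \<ge> 1 \<Longrightarrow>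
      norm (Tm m t (orth_proj (Hm m) u0) - T t u0)
        \<le> C * real m powr (- (p1 + p2)) * graph_norm (frac_power A (s + 1)) u0"
    using galerkin_error_estimate[OF assms(1-11,14,15)] by blast
  have mult_quotient_eq: "c * (x / real m powr (p1 + p2)) = c * real m powr (- (p1 + p2)) * x" for c x m
    by (simp only: powr_minus divide_inverse mult_ac)
  show ?thesis
  proof (intro conjI allI impI)
    show "\<exists>C. \<forall>t\<in>{0..Tbar}. \<forall>u0\<in>Domain (frac_power A (s + 1)). \<forall>m\<ge>1.
            norm (Tm m t (orth_proj (Hm m) u0) - T t u0)
              \<le> C * (graph_norm (frac_power A (s + 1)) u0 / real m powr (p1 + p2))" for Tbar
      unfolding mult_quotient_eq by (intro exI[of _ C] ballI allI impI bound) auto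
    assume "p1 + p2 > 0"
    then show "evolution_convergence_of_order T Hm Tm
              (Domain (frac_power A (s + 1))) (graph_norm (frac_power A (s + 1))) (p1 + p2)"
      unfolding evolution_convergence_of_order_def
      by (intro conjI allI impI exI[of _ C] ballI C bound) auto
  qed
qed

end
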